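(* Let $0\le p<1$, $\delta\in(0,1)$, $\epsilon\in[0,1]$, and consider the noiseless case $\sigma_w=0$. (1) If $\overline{M}_p(\epsilon)<\delta$, then for every $p_X\in\mathcal{F}_\epsilon$ the highest stable fixed point of $\Psi_{\lambda_*,p}$ is at zero; in other words, $\Psi_{\lambda_*,p}(\sigma^2)$ has a unique stable fixed point, and it is at zero. (2) If $\underline{M}_p(\epsilon)>\delta$, then there exists a distribution $p_X\in\mathcal{F}_\epsilon$ for which $\Psi_{\lambda_*,p}(\sigma^2)$ has more than one stable fixed point.
   Context: For $0\le p\le1$, $\lambda\ge0$, $u\in\mathbb{R}$: $\eta_p(u;\lambda)=\arg\min_{x\in\mathbb{R}}\frac12(u-x)^2+\lambda|x|^p$ (with $|x|^0=\mathbb{I}(x\neq0)$), the value $0$ being chosen when the minimizer is not unique. $\mathcal{F}_\epsilon$ is the set of probability distributions $p_X$ on $\mathbb{R}$ (with finite second moment) such that $P(X\ne0)\le\epsilon$ for $X\sim p_X$. State evolution map with optimal thresholding policy $\lambda_*(\sigma)\in\arg\min_{\lambda\ge0}\mathbb{E}|\eta_p(X+\sigma Z;\lambda)-X|^2$: for $\sigma\ge0$, $$\Psi_{\lambda_*,p}(\sigma^2)=\sigma_w^2+\frac1\delta\inf_{\lambda\ge0}\mathbb{E}\left|\eta_p(X+\sigma Z;\lambda)-X\right|^2,$$ with $X\sim p_X$ and $Z\sim N(0,1)$ independent. Stable fixed point: $\sigma_f>0$ with $\Psi(\sigma_f^2)=\sigma_f^2$ is stable if there is an open interval $I\ni\sigma_f$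 such that $\Psi(\sigma^2)<\sigma^2$ for all $\sigma>\sigma_f$ in $I$ and $\Psi(\sigma^2)>\sigma^2$ for all $\sigma<\sigma_f$ in $I$. Zero is a stable fixed point if $\Psi(0)=0$ and there is $\sigma_i>0$ with $\Psi(\sigma^2)<\sigma^2$ for all $0<\sigma<\sigma_i$. With $Z\sim N(0,1)$, $$\overline{M}_p(\epsilon)=\inf_{\tau\ge0}\sup_{\mu\ge0}\left[(1-\epsilon)\mathbb{E}(\eta_p(Z;\tau))^2+\epsilon\,\mathbb{E}(\eta_p(\mu+Z;\tau)-\mu)^2\right],$$ $$\underline{M}_p(\epsilon)=\sup_{\mu\ge0}\inf_{\tau\ge0}\left[(1-\epsilon)\mathbb{E}(\eta_p(Z;\tau))^2+\epsilon\,\mathbb{E}(\eta_p(\mu+Z;\tau)-\mu)^2\right].$$ *)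

theory Defs
  imports "HOL-Probability.Probability"
begin

(* For p = 0 the penalty is the indicator of x being nonzero, because 0 powr 0 = 0
   and y powr 0 = 1 for y > 0. *)
definition prox_objective :: "real \<Rightarrow> real \<Rightarrow> real \<Rightarrow> real \<Rightarrow> real" where
  "prox_objective p l u x = (u - x)\<^sup>2 / 2 + l * \<bar>x\<bar> powr p"

definition eta :: "real \<Rightarrow> real \<Rightarrow> real \<Rightarrow> real" where
  "eta p u l =
     (if \<exists>!x. is_arg_min (prox_objective p l u) (\<lambda>_. True) x
      then (THE x. is_arg_min (prox_objective p l u) (\<lambda>_. True) x)
      else 0)"

definition sparse_distributions :: "real \<Rightarrow> real measure set" where
  "sparse_distributions \<epsilon> =
     {M. real_distribution M \<and> integrable M (\<lambda>x. x\<^sup>2) \<and> measure M {x. x \<noteq> 0} \<le> \<epsilon>}"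

(* Independence of X and Z is encoded by the product measure.  For 0 <= p <= 1 and
   l >= 0 one has \<bar>eta p u l - u\<bar> <= (2 * l) powr (1 / (2 - p)),
   so the integrand here is always integrable, and below every real-valued SUP ranges
   over a set bounded above, every INF over a set bounded below. *)
definition thresholding_risk :: "real \<Rightarrow> real measure \<Rightarrow> real \<Rightarrow> real \<Rightarrow> real" where
  "thresholding_risk p M \<sigma> l =
     (\<integral>(x, z). (eta p (x + \<sigma> * z) l - x)\<^sup>2 \<partial>(M \<Otimes>\<^sub>M std_normal_distribution))"

(* The argument v is the variance \<sigma>^2, with \<sigma> >= 0.  The optimal threshold
   \<lambda>_*(\<sigma>) enters only through the risk it attains, which is the infimum. *)
definition state_evolution ::
    "real \<Rightarrow> real \<Rightarrow> real \<Rightarrow> real measure \<Rightarrow> real \<Rightarrow> real" where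
  "state_evolution p \<delta> \<sigma>\<^sub>w M v =
     \<sigma>\<^sub>w\<^sup>2 + 1 / \<delta> * (INF l\<in>{0..}. thresholding_risk p M (sqrt v) l)"

(* Fixed points are indexed by \<sigma> >= 0, while \<Psi> is a function of the variance.
   The interval around a positive fixed point is taken inside the domain \<sigma> >= 0. *)
definition stable_fixed_point :: "(real \<Rightarrow> real) \<Rightarrow> real \<Rightarrow> bool" where
  "stable_fixed_point \<Psi> \<sigma> \<longleftrightarrow>
     \<Psi> (\<sigma>\<^sup>2) = \<sigma>\<^sup>2 \<and>
     (\<sigma> > 0 \<and>
        (\<exists>a b. 0 \<le> a \<and> a < \<sigma> \<and> \<sigma> < b \<and>
           (\<forall>s\<in>{\<sigma><..<b}. \<Psi> (s\<^sup>2) < s\<^sup>2) \<and>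
           (\<forall>s\<in>{a<..<\<sigma>}. \<Psi> (s\<^sup>2) > s\<^sup>2))
      \<or> \<sigma> = 0 \<and> (\<exists>b>0. \<forall>s\<in>{0<..<b}. \<Psi> (s\<^sup>2) < s\<^sup>2))"

definition two_point_risk :: "real \<Rightarrow> real \<Rightarrow> real \<Rightarrow> real \<Rightarrow> real" where
  "two_point_risk p \<epsilon> \<mu> \<tau> =
     (1 - \<epsilon>) * (\<integral>z. (eta p z \<tau>)\<^sup>2 \<partial>std_normal_distribution)
     + \<epsilon> * (\<integral>z. (eta p (\<mu> + z) \<tau> - \<mu>)\<^sup>2 \<partial>std_normal_distribution)"

definition M_upper :: "real \<Rightarrow> real \<Rightarrow> real" where
  "M_upper p \<epsilon> = (INF \<tau>\<in>{0..}. SUP \<mu>\<in>{0..}. two_point_risk p \<epsilon> \<mu> \<tau>)"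

definition M_lower :: "real \<Rightarrow> real \<Rightarrow> real" where
  "M_lower p \<epsilon> = (SUP \<mu>\<in>{0..}. INF \<tau>\<in>{0..}. two_point_risk p \<epsilon> \<mu> \<tau>)"

end

theory Submission
  imports Defs "HOL-Real_Asymp.Real_Asymp"
begin

text \<open>By scaling, the state evolution map at sigma^2 equals sigma^2 / delta times the infimum over tau
  of the averages of b(X / sigma; tau), where b(m; tau) is the risk of estimating m from m + Z.  So
  fixed points are solutions of "infimum = delta", and part (1) is the bound of every such average
  by the value of the worst two-point law.

  For part (2) zero is stable as soon as P(X \<noteq> 0) < delta, because b(m; tau) tends to 1 as m grows
  (this uses p < 1) while b(0; tau) tends to 0 as tau grows.  A second stable fixed point arises
  where the infimum, as a function of v = 1 / sigma, crosses the level delta upwards.  That crossing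
  has to be strict on both sides; this is arranged by moving a small mass to an atom far out, where
  the risk is almost 1 for every threshold, and by the semiconcavity of the infimum in v.\<close>

section \<open>The thresholding function\<close>

text \<open>An upward crossing exists with v in (0, 1): at v = 1 a hard law keeps the infimum above
  \<delta>, while for small v estimating by 0 costs only v^2 E X^2. But an infimum of risks of a
  possibly discontinuous \<open>eta\<close> over an unbounded range of thresholds need not cross
  cleanly: nothing excludes touching, or infinitely many crossings near one point. All regularity
  must therefore be uniform in the threshold. It comes from taking the noisy observation as
  integration variable, so that the parameter occurs only in a square and in the Gaussian factor;
  the bound |eta u| \<le> |u| is then the only estimate on \<open>eta\<close> that enters. An
  infimum inherits upper bounds on second differences, not lower ones, which is why a linear gain is
  established on the right and transferred to the left. The extra atom needs room below \<epsilon>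
  and the stability of zero needs P(X \<noteq> 0) < \<delta>, so hard laws are first diluted by
  additional mass at 0.\<close>

lemma prox_objective_scale:
  assumes "c \<noteq> 0"
  shows "prox_objective p (\<bar>c\<bar> powr (2 - p) * l) (c * u) (c * x) = c\<^sup>2 * prox_objective p l u x"
proof -
  have "\<bar>c\<bar> powr (2 - p) * \<bar>c\<bar> powr p = \<bar>c\<bar> powr 2"
    by (simp flip: powr_add)
  also have "\<dots> = c\<^sup>2" using assms by (simp add: powr_numeral)
  finally have "\<bar>c\<bar> powr (2 - p) * l * \<bar>c * x\<bar> powr p = c\<^sup>2 * (l * \<bar>x\<bar> powr p)"
    by (simp add: abs_mult powr_mult algebra_simps)
  then show ?thesis
    unfolding prox_objective_def by (simp add: power2_eq_square algebra_simps)
qed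

text \<open>The square scales like c^2 and the penalty like |c|^p, so the threshold must carry
  |c|^(2 - p). Minimizers then correspond under x -> c x, and so does their uniqueness; the tie
  value 0 is fixed by this map. The case c = -1 gives oddness.\<close>

lemma eta_scale:
  assumes "c \<noteq> 0"
  shows "eta p (c * u) (\<bar>c\<bar> powr (2 - p) * l) = c * eta p u l"
proof -
  define P where "P = is_arg_min (prox_objective p l u) (\<lambda>_. True)"
  define Q where
    "Q = is_arg_min (prox_objective p (\<bar>c\<bar> powr (2 - p) * l) (c * u)) (\<lambda>_. True)"
  have QP: "Q (c * x) \<longleftrightarrow> P x" for x
  proof -
    have "Q (c * x) \<longleftrightarrow> (\<forall>y. prox_objective p (\<bar>c\<bar> powr (2 - p) * l) (c * u) (c * x)
        \<le> prox_objective p (\<bar>c\<bar> powr (2 - p) * l) (c * u) (c * y))"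
      unfolding Q_def is_arg_min_linorder
      by (metis assms nonzero_mult_div_cancel_left times_divide_eq_right)
    also have "\<dots> \<longleftrightarrow> P x"
      using assms unfolding P_def is_arg_min_linorder prox_objective_scale[OF assms] by simp
    finally show ?thesis .
  qed
  have QP': "Q x \<longleftrightarrow> P (x / c)" for x
    using QP[of "x / c"] assms by simp
  show ?thesis
  proof (cases "\<exists>!x. P x")
    case True
    then obtain x where x: "P x" "\<And>y. P y \<Longrightarrow> y = x" by blast
    have P: "P = (\<lambda>y. y = x)" using x by blast
    have Q: "Q = (\<lambda>y. y = c * x)"
      using QP' assms unfolding P by (auto simp: fun_eq_iff field_simps)
    have "eta p u l = x" unfolding eta_def P_def[symmetric] P by simp
    moreover have "eta p (c * u) (\<bar>c\<bar> powr (2 - p) * l) = c * x"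
      unfolding eta_def Q_def[symmetric] Q by simp
    ultimately show ?thesis by simp
  next
    case False
    then have "\<not> (\<exists>!x. Q x)"
      using QP QP' assms by (metis nonzero_mult_div_cancel_left)
    then show ?thesis
      using False unfolding eta_def P_def[symmetric] Q_def[symmetric] by auto
  qed
qed

lemma eta_minus [simp]: "eta p (- u) l = - eta p u l"
  using eta_scale[of "-1" p u l] by simp

lemma powr_subadditive:
  fixes x y p :: real
  assumes "0 \<le> x" "0 \<le> y" "0 \<le> p" "p < 1"
  shows "(x + y) powr p \<le> x powr p + y powr p"
proof (cases "x = 0 \<or> y = 0")
  case False
  then have pos: "0 < x" "0 < y" using assms by auto
  have split: "z powr p = z * z powr (p - 1)" if "0 < z" for z :: real
    using that powr_add[of z 1 "p - 1"] by simp
  have "(x + y) powr p = x * (x + y) powr (p - 1) + y * (x + y) powr (p - 1)"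
    using pos by (subst split) (auto simp: algebra_simps)
  also have "\<dots> \<le> x * x powr (p - 1) + y * y powr (p - 1)"
    using pos assms by (intro add_mono mult_left_mono powr_mono2') auto
  finally show ?thesis using pos split by simp
qed auto

section \<open>Existence, uniqueness and shape of the minimizers\<close>

context
  fixes p l :: real
  assumes p: "0 \<le> p" "p < 1" and l: "0 \<le> l"
begin

text \<open>For p = 0 the objective may jump at 0, so the candidates 0 and u are compared by hand.
  For p > 0 it is continuous, and beyond 2|u| the quadratic term alone is no smaller than the value
  at 0.\<close>

lemma prox_objective_has_minimizer: "\<exists>x. \<forall>y. prox_objective p l u x \<le> prox_objective p l u y"
proof (cases "p = 0")
  case True
  have f: "prox_objective p l u x = (u - x)\<^sup>2 / 2 + (if x = 0 then 0 else l)" for x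
    using True by (simp add: prox_objective_def)
  show ?thesis
  proof (cases "u\<^sup>2 / 2 \<le> l")
    case True
    have "prox_objective p l u 0 \<le> prox_objective p l u y" for y
      using True unfolding f by (simp add: add_increasing)
    then show ?thesis by blast
  next
    case False
    have "prox_objective p l u u \<le> prox_objective p l u y" for y
      using False l unfolding f by auto
    then show ?thesis by blast
  qed
next
  case False
  have "continuous_on {- 2 * \<bar>u\<bar>..2 * \<bar>u\<bar>} (prox_objective p l u)"
    unfolding prox_objective_def using p False
    by (intro continuous_intros continuous_on_powr') auto
  then obtain x where x: "x \<in> {- 2 * \<bar>u\<bar>..2 * \<bar>u\<bar>}"
      "\<And>y. y \<in> {- 2 * \<bar>u\<bar>..2 * \<bar>u\<bar>} \<Longrightarrow> prox_objective p l u x \<le> prox_objective p l u y"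
    using continuous_attains_inf[of "{- 2 * \<bar>u\<bar>..2 * \<bar>u\<bar>}" "prox_objective p l u"] by auto
  have "prox_objective p l u x \<le> prox_objective p l u y" for y
  proof (cases "y \<in> {- 2 * \<bar>u\<bar>..2 * \<bar>u\<bar>}")
    case False
    then have "\<bar>u\<bar> \<le> \<bar>u - y\<bar>" by auto
    then have "u\<^sup>2 \<le> (u - y)\<^sup>2" by (simp only: abs_le_square_iff)
    moreover have "0 \<le> l * \<bar>y\<bar> powr p" using l by simp
    ultimately have "prox_objective p l u 0 \<le> prox_objective p l u y"
      unfolding prox_objective_def by simp
    then show ?thesis using x(2)[of 0] by simp
  qed (use x in auto)
  then show ?thesis by blast
qed

lemma minimizer_sign:
  assumes "\<forall>y. prox_objective p l u x \<le> prox_objective p l u y"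
  shows "0 \<le> u * x"
  using assms[rule_format, of "- x"] unfolding prox_objective_def
  by (simp add: power2_eq_square algebra_simps)

lemma minimizer_at_zero:
  assumes "\<forall>y. prox_objective p l 0 x \<le> prox_objective p l 0 y"
  shows "x = 0"
proof -
  have "x\<^sup>2 / 2 + l * \<bar>x\<bar> powr p \<le> 0"
    using assms[rule_format, of 0] unfolding prox_objective_def by simp
  moreover have "0 \<le> l * \<bar>x\<bar> powr p" using l by simp
  ultimately have "x\<^sup>2 \<le> 0" by linarith
  then show ?thesis by simp
qed

lemma prox_objective_deriv:
  assumes "0 < x"
  shows "(prox_objective p l u has_real_derivative x - u + l * (p * x powr (p - 1))) (at x)"
proof -
  have "((\<lambda>x. (u - x)\<^sup>2 / 2 + l * x powr p) has_real_derivative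
      x - u + l * (p * x powr (p - 1))) (at x)"
    using assms by (auto intro!: derivative_eq_intros simp: field_simps)
  then show ?thesis
    by (rule DERIV_cong_ev[THEN iffD1, rotated -1])
      (use assms in \<open>auto simp: prox_objective_def eventually_nhds intro!: exI[of _ "{0<..}"]\<close>)
qed

lemma minimizer_stationary:
  assumes "\<forall>y. prox_objective p l u x \<le> prox_objective p l u y" "0 < x"
  shows "u - x = l * p * x powr (p - 1)"
proof -
  have "x - u + l * (p * x powr (p - 1)) = 0"
    using DERIV_local_min[OF prox_objective_deriv[OF assms(2)], of 1 u] assms(1) by auto
  then show ?thesis by simp
qed

text \<open>By Rolle's theorem two positive minimizers would give three critical points, hence two
  distinct zeros of the second derivative, which is injective on the positive half-line.\<close>

lemma positive_minimizer_unique: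
  assumes x: "\<forall>z. prox_objective p l u x \<le> prox_objective p l u z" "0 < x"
    and y: "\<forall>z. prox_objective p l u y \<le> prox_objective p l u z" "x < y"
  shows False
proof -
  let ?f' = "\<lambda>x. x - u + l * (p * x powr (p - 1))"
  let ?f'' = "\<lambda>x. 1 + l * (p * ((p - 1) * x powr (p - 2)))"
  have d': "(?f' has_real_derivative ?f'' z) (at z)" if "0 < z" for z
    using that by (auto intro!: derivative_eq_intros)
  have "prox_objective p l u x = prox_objective p l u y"
    using x(1)[rule_format, of y] y(1)[rule_format, of x] by (rule antisym)
  then obtain c where c: "x < c" "c < y" "?f' c = 0"
    using MVT2[of x y "prox_objective p l u" ?f'] prox_objective_deriv x y by auto
  have 0: "?f' x = 0" "?f' y = 0"
    using minimizer_stationary[OF x] minimizer_stationary[OF y(1)] x y by auto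
  have rolle: "\<exists>d>a. d < b \<and> ?f'' d = 0" if "0 < a" "a < b" "?f' a = 0" "?f' b = 0" for a b
  proof -
    have "\<exists>z>a. z < b \<and> ?f' b - ?f' a = (b - a) * ?f'' z"
      using that by (intro MVT2 d') auto
    then show ?thesis using that by auto
  qed
  obtain d e where de: "x < d" "d < c" "?f'' d = 0" "c < e" "e < y" "?f'' e = 0"
    using rolle[of x c] rolle[of c y] c 0 x by auto
  have eq: "l * p * (p - 1) * d powr (p - 2) = -1" "l * p * (p - 1) * e powr (p - 2) = -1"
    using de by (auto simp: algebra_simps)
  then have "l * p * (p - 1) * d powr (p - 2) = l * p * (p - 1) * e powr (p - 2)"
    by simp
  moreover have "l * p * (p - 1) \<noteq> 0"
    using eq by auto
  ultimately have "d powr (p - 2) = e powr (p - 2)"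
    by (metis mult_left_cancel)
  moreover have "e powr (p - 2) < d powr (p - 2)"
    using de x p by (intro powr_less_mono2_neg) auto
  ultimately show False by simp
qed

text \<open>Nonzero minimizers share the sign of u, so the positive case applies directly or, for u
  < 0, after reflection.\<close>

lemma nonzero_minimizer_unique:
  assumes x: "\<forall>z. prox_objective p l u x \<le> prox_objective p l u z" "x \<noteq> 0"
    and y: "\<forall>z. prox_objective p l u y \<le> prox_objective p l u z" "y \<noteq> 0"
  shows "x = y"
proof -
  have pos: "a = b"
    if "\<forall>z. prox_objective p l v a \<le> prox_objective p l v z" "0 < a"
      "\<forall>z. prox_objective p l v b \<le> prox_objective p l v z" "0 < b" for a b v
    using positive_minimizer_unique[of v a b] positive_minimizer_unique[of v b a] that
    by (metis linorder_neqE_linordered_idom)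
  have refl: "prox_objective p l (- u) (- z) = prox_objective p l u z" for z
    using prox_objective_scale[of "-1" p l u z] by simp
  then have refl': "prox_objective p l (- u) z = prox_objective p l u (- z)" for z
    by (metis minus_minus)
  have "u \<noteq> 0" using minimizer_at_zero x by auto
  then consider "0 < u" "0 < x" "0 < y" | "u < 0" "x < 0" "y < 0"
    using minimizer_sign[OF x(1)] minimizer_sign[OF y(1)] x y
    by (auto simp: zero_le_mult_iff)
  then show ?thesis
  proof cases
    case 1
    then show ?thesis using pos x y by blast
  next
    case 2
    then have "- x = - y" using x y by (intro pos[of "- u"]) (auto simp: refl refl')
    then show ?thesis by simp
  qed
qed

text \<open>In a tie at most one minimizer is nonzero, hence another one is 0: the default value in
  \<open>eta\<close> is itself a minimizer.\<close>

lemma eta_minimizer: "prox_objective p l u (eta p u l) \<le> prox_objective p l u y"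
proof (cases "\<exists>!x. is_arg_min (prox_objective p l u) (\<lambda>_. True) x")
  case True
  then have "is_arg_min (prox_objective p l u) (\<lambda>_. True) (eta p u l)"
    unfolding eta_def by (simp add: theI')
  then show ?thesis by (simp add: is_arg_min_linorder)
next
  case False
  obtain x where x: "\<forall>z. prox_objective p l u x \<le> prox_objective p l u z"
    using prox_objective_has_minimizer by blast
  then obtain y where y: "\<forall>z. prox_objective p l u y \<le> prox_objective p l u z" "y \<noteq> x"
    using False by (auto simp: is_arg_min_linorder Ex1_def)
  then have "x = 0 \<or> y = 0" using nonzero_minimizer_unique x by blast
  moreover have "eta p u l = 0" using False by (simp add: eta_def)
  ultimately show ?thesis using x y by auto
qed

lemma eta_sign: "0 \<le> u * eta p u l"
  using minimizer_sign eta_minimizer by blast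

lemma eta_nonneg: "0 \<le> u \<Longrightarrow> 0 \<le> eta p u l"
proof (cases "u = 0")
  case True
  then show ?thesis using minimizer_at_zero[of "eta p 0 l"] eta_minimizer[of 0] by simp
next
  case False
  moreover assume "0 \<le> u"
  ultimately show ?thesis using eta_sign[of u] by (simp add: zero_le_mult_iff)
qed

lemma eta_abs_le: "\<bar>eta p u l\<bar> \<le> \<bar>u\<bar>"
proof (rule ccontr)
  assume *: "\<not> \<bar>eta p u l\<bar> \<le> \<bar>u\<bar>"
  then have "\<bar>u\<bar> powr p \<le> \<bar>eta p u l\<bar> powr p"
    using p by (intro powr_mono2) auto
  then have "l * \<bar>u\<bar> powr p \<le> l * \<bar>eta p u l\<bar> powr p"
    using l by (rule mult_left_mono)
  moreover have "(u - eta p u l)\<^sup>2 / 2 + l * \<bar>eta p u l\<bar> powr p \<le> l * \<bar>u\<bar> powr p"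
    using eta_minimizer[of u u] unfolding prox_objective_def by simp
  ultimately have "(u - eta p u l)\<^sup>2 / 2 \<le> 0" by linarith
  then have "u = eta p u l" by (simp add: divide_le_0_iff)
  then show False using * by simp
qed

text \<open>Adding the optimality inequalities at u and v cancels the penalties and leaves a product
  of increments. Measurability of the possibly discontinuous \<open>eta\<close> follows from
  this.\<close>

lemma eta_mono: "u \<le> v \<Longrightarrow> eta p u l \<le> eta p v l"
proof (cases "u = v")
  case False
  assume "u \<le> v"
  then have "u < v" using False by simp
  have "prox_objective p l u (eta p u l) + prox_objective p l v (eta p v l)
      \<le> prox_objective p l u (eta p v l) + prox_objective p l v (eta p u l)"
    using eta_minimizer by (intro add_mono)
  then have "0 \<le> (v - u) * (eta p v l - eta p u l)"
    unfolding prox_objective_def by (simp add: power2_eq_square field_simps)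
  then show ?thesis using \<open>u < v\<close> by (simp add: zero_le_mult_iff)
qed simp

lemma borel_measurable_eta [measurable]: "(\<lambda>u. eta p u l) \<in> borel_measurable borel"
  by (intro borel_measurable_mono monoI eta_mono)

lemma eta_stationary: "0 < eta p u l \<Longrightarrow> u - eta p u l = l * p * eta p u l powr (p - 1)"
  using minimizer_stationary eta_minimizer by blast

text \<open>On the positive branch the shrinkage u - eta equals l p eta^(p - 1), which does not
  increase as eta grows because p < 1; increments of \<open>eta\<close> therefore dominate those of
  its argument.\<close>

lemma eta_expansive:
  assumes "0 < eta p u l" "u \<le> v"
  shows "v - u \<le> eta p v l - eta p u l"
proof -
  have le: "eta p u l \<le> eta p v l" using eta_mono assms by blast
  then have "eta p v l powr (p - 1) \<le> eta p u l powr (p - 1)"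
    using assms p by (intro powr_mono2') auto
  then have "l * p * eta p v l powr (p - 1) \<le> l * p * eta p u l powr (p - 1)"
    using p l by (intro mult_left_mono) auto
  then show ?thesis using eta_stationary[of u] eta_stationary[of v] assms le by simp
qed

text \<open>Beating the candidate 0 with |eta| = x > 0 forces l x^p \<le> |u| x, hence l \<le> |u|
  x^(1 - p) \<le> |u|^(2 - p).\<close>

lemma eta_eq_0:
  assumes "\<bar>u\<bar> powr (2 - p) < l"
  shows "eta p u l = 0"
proof (rule ccontr)
  define x where "x = \<bar>eta p u l\<bar>"
  assume "eta p u l \<noteq> 0"
  then have x: "0 < x" "x \<le> \<bar>u\<bar>" using eta_abs_le by (auto simp: x_def)
  have "l * x powr p \<le> u * eta p u l - (eta p u l)\<^sup>2 / 2"
    using eta_minimizer[of u 0] unfolding prox_objective_def x_def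
    by (simp add: power2_eq_square field_simps)
  also have "\<dots> \<le> u * eta p u l" by simp
  also have "\<dots> \<le> \<bar>u\<bar> * x"
    using abs_ge_self[of "u * eta p u l"] by (simp add: x_def abs_mult)
  finally have "l * x powr p \<le> \<bar>u\<bar> * x" .
  moreover have "x powr (1 - p) * x powr p = x"
    using x by (subst powr_add[symmetric]) simp
  ultimately have "l * x powr p \<le> (\<bar>u\<bar> * x powr (1 - p)) * x powr p"
    by (simp only: mult.assoc)
  then have "l \<le> \<bar>u\<bar> * x powr (1 - p)" using x by simp
  also have "\<dots> \<le> \<bar>u\<bar> * \<bar>u\<bar> powr (1 - p)"
    using x p by (intro mult_left_mono powr_mono2) auto
  also have "\<dots> = \<bar>u\<bar> powr (2 - p)"
    using x powr_add[of "\<bar>u\<bar>" 1 "1 - p"] by simp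
  finally show False using assms by simp
qed

text \<open>Comparison with the candidate u gives d^2 / 2 \<le> l d^p for the displacement d, by
  subadditivity. The 1 in the bound covers d < 1, where d^p \<le> d may fail.\<close>

lemma eta_shrinkage_bounded: "\<bar>eta p u l - u\<bar> \<le> 1 + 2 * l"
proof (rule ccontr)
  define d where "d = \<bar>eta p u l - u\<bar>"
  assume "\<not> \<bar>eta p u l - u\<bar> \<le> 1 + 2 * l"
  then have d: "1 + 2 * l < d" by (simp add: d_def)
  have "\<bar>u\<bar> powr p \<le> (\<bar>eta p u l\<bar> + d) powr p"
    using p by (intro powr_mono2) (auto simp: d_def)
  also have "\<dots> \<le> \<bar>eta p u l\<bar> powr p + d powr p"
    using d l p by (intro powr_subadditive) auto
  finally have "l * (\<bar>u\<bar> powr p - \<bar>eta p u l\<bar> powr p) \<le> l * d powr p"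
    using l by (intro mult_left_mono) auto
  also have "\<dots> \<le> l * d"
    using l d p powr_mono[of p 1 d] by (intro mult_left_mono) auto
  finally have "d\<^sup>2 / 2 \<le> l * d"
    using eta_minimizer[of u u] unfolding prox_objective_def d_def
    by (simp add: algebra_simps power2_commute)
  then have "d * d \<le> (2 * l) * d" by (simp add: power2_eq_square)
  then show False using d l by (simp add: mult_le_cancel_right)
qed

text \<open>By stationarity the bias is l p eta^(p - 1), and \<open>eta\<close> stays within a
  constant of u, so the bias vanishes. For p = 1 it would remain l.\<close>

lemma eta_asymptotic: "((\<lambda>u. eta p u l - u) \<longlongrightarrow> 0) at_top"
proof (rule Lim_null_comparison)
  show "\<forall>\<^sub>F u in at_top. norm (eta p u l - u) \<le> l * p * (u - (1 + 2 * l)) powr (p - 1)"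
    using eventually_gt_at_top[of "1 + 2 * l"]
  proof eventually_elim
    case (elim u)
    have le: "u - (1 + 2 * l) \<le> eta p u l" using eta_shrinkage_bounded[of u] by simp
    then have "0 < eta p u l" using elim by simp
    then have eq: "u - eta p u l = l * p * eta p u l powr (p - 1)" by (rule eta_stationary)
    have "norm (eta p u l - u) = l * p * eta p u l powr (p - 1)"
      using eq p l by (simp add: abs_minus_commute[of _ u])
    also have "\<dots> \<le> l * p * (u - (1 + 2 * l)) powr (p - 1)"
      using le elim p l by (intro mult_left_mono powr_mono2') auto
    finally show ?case .
  qed
  have "((\<lambda>u. (u - (1 + 2 * l)) powr (p - 1)) \<longlongrightarrow> 0) at_top"
    using p
    by (intro tendsto_neg_powr) (auto, real_asymp)
  then show "((\<lambda>u. l * p * (u - (1 + 2 * l)) powr (p - 1)) \<longlongrightarrow> 0) at_top"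
    by (rule tendsto_mult_right_zero)
qed

end

lemma eta_zero_threshold [simp]:
  assumes "0 \<le> p" "p < 1"
  shows "eta p u 0 = u"
  using eta_minimizer[of p 0 u u] assms by (simp add: prox_objective_def)

section \<open>The risk at a point\<close>

interpretation std_normal: real_distribution std_normal_distribution
  by (rule real_dist_normal_dist)

lemma std_normal_integrable_sq: "integrable std_normal_distribution (\<lambda>z. z\<^sup>2)"
  using integrable_std_normal_distribution_moment[of 2] .

lemma std_normal_integral_sq: "(\<integral>z. z\<^sup>2 \<partial>std_normal_distribution) = 1"
  using std_normal_distribution_even_moments(1)[of 1] by (simp add: fact_numeral)

lemma std_normal_integrable_quadratic:
  "integrable std_normal_distribution (\<lambda>z. (c + \<bar>z\<bar>)\<^sup>2)"
proof -
  have "integrable std_normal_distribution (\<lambda>z. \<bar>z\<bar>)"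
    using integrable_std_normal_distribution_moment[of 1] by (intro integrable_abs) simp
  moreover have "(\<lambda>z::real. (c + \<bar>z\<bar>)\<^sup>2) = (\<lambda>z. c\<^sup>2 + 2 * c * \<bar>z\<bar> + z\<^sup>2)"
    by (simp add: power2_sum fun_eq_iff)
  ultimately show ?thesis using std_normal_integrable_sq by simp
qed

lemma std_normal_integral_uminus:
  fixes f :: "real \<Rightarrow> real"
  assumes [measurable]: "f \<in> borel_measurable borel"
  shows "(\<integral>z. f (- z) \<partial>std_normal_distribution) = (\<integral>z. f z \<partial>std_normal_distribution)"
proof -
  have "(\<integral>z. f z \<partial>std_normal_distribution) = (\<integral>z. std_normal_density z * f z \<partial>lborel)"
    by (subst integral_density) auto
  also have "\<dots> = (\<integral>z. std_normal_density (- z) * f (- z) \<partial>lborel)"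
    by (subst lborel_integral_real_affine[of "-1" _ 0]) auto
  also have "\<dots> = (\<integral>z. std_normal_density z * f (- z) \<partial>lborel)"
    by (simp add: normal_density_def)
  also have "\<dots> = (\<integral>z. f (- z) \<partial>std_normal_distribution)"
    by (subst integral_density) auto
  finally show ?thesis by simp
qed

lemma std_normal_integrable_uminus:
  fixes f :: "real \<Rightarrow> real"
  assumes "integrable std_normal_distribution f"
  shows "integrable std_normal_distribution (\<lambda>z. f (- z))"
proof -
  have [measurable]: "f \<in> borel_measurable borel"
    using borel_measurable_integrable[OF assms] by simp
  have "integrable lborel (\<lambda>z. std_normal_density z * f z)"
    using assms by (subst (asm) integrable_density) auto
  then have "integrable lborel (\<lambda>z. std_normal_density (- z) * f (- z))"
    using lborel_integrable_real_affine[of "\<lambda>z. std_normal_density z * f z" "-1" 0] by simp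
  then show ?thesis
    by (subst integrable_density) (auto simp: normal_density_def)
qed

lemma std_normal_integral_pos:
  fixes f :: "real \<Rightarrow> real"
  assumes f: "integrable std_normal_distribution f" "\<And>z. 0 \<le> f z"
    and pos: "\<And>z. a < z \<Longrightarrow> z < b \<Longrightarrow> 0 < f z" and "a < b"
  shows "0 < (\<integral>z. f z \<partial>std_normal_distribution)"
proof (rule ccontr)
  have [measurable]: "f \<in> borel_measurable borel"
    using borel_measurable_integrable[OF f(1)] by simp
  assume "\<not> 0 < (\<integral>z. f z \<partial>std_normal_distribution)"
  moreover have "0 \<le> (\<integral>z. f z \<partial>std_normal_distribution)"
    using f(2) by simp
  ultimately have "(\<integral>z. f z \<partial>std_normal_distribution) = 0" by linarith
  then have "AE z in std_normal_distribution. f z = 0"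
    using f by (subst (asm) integral_nonneg_eq_0_iff_AE) auto
  then have "AE z in lborel. f z = 0"
    by (subst (asm) AE_density) (auto simp: normal_density_pos)
  then have "AE z in lborel. z \<notin> {a<..<b}"
    by eventually_elim (use pos in force)
  then have "emeasure lborel {a<..<b} = 0"
    by (subst (asm) AE_iff_measurable[of "{a<..<b}"]) auto
  then show False using \<open>a < b\<close> by simp
qed

text \<open>Two mean values of first order and one of second order; the intermediate points are less
  than 2h apart. The factor 2 is not sharp, but harmless.\<close>

lemma second_difference_bound:
  fixes g g' g'' :: "real \<Rightarrow> real"
  assumes g: "\<And>x. m - h \<le> x \<Longrightarrow> x \<le> m + h \<Longrightarrow> (g has_real_derivative g' x) (at x)"
    and g': "\<And>x. m - h \<le> x \<Longrightarrow> x \<le> m + h \<Longrightarrow> (g' has_real_derivative g'' x) (at x)"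
    and W: "\<And>x. m - h \<le> x \<Longrightarrow> x \<le> m + h \<Longrightarrow> \<bar>g'' x\<bar> \<le> W"
    and "0 \<le> h"
  shows "g (m + h) + g (m - h) - 2 * g m \<le> W * (2 * h\<^sup>2)"
proof (cases "h = 0")
  case False
  then have h: "0 < h" using \<open>0 \<le> h\<close> by simp
  obtain r where r: "m < r" "r < m + h" "g (m + h) - g m = h * g' r"
    using MVT2[of m "m + h" g g'] g h by auto
  obtain s where s: "m - h < s" "s < m" "g m - g (m - h) = h * g' s"
    using MVT2[of "m - h" m g g'] g h by auto
  obtain t where t: "s < t" "t < r" "g' r - g' s = (r - s) * g'' t"
    using MVT2[of s r g' g''] g' r s by auto
  have "(r - s) * g'' t \<le> (r - s) * W"
    using W[of t] r s t by (intro mult_left_mono) auto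
  also have "\<dots> \<le> (2 * h) * W"
    using W[of m] h r s by (intro mult_right_mono) auto
  finally have "(r - s) * g'' t \<le> (2 * h) * W" .
  then have "h * (g' r - g' s) \<le> h * (2 * h * W)"
    using h t(3) by (intro mult_left_mono) auto
  then show ?thesis
    using r(3) s(3) by (simp add: power2_eq_square algebra_simps)
qed simp

text \<open>exp (c |u|) is at most exp (c u) + exp (- c u), and completing the square turns each
  summand into a multiple of a shifted normal density. This provides the integrable majorant for the
  derivatives in m.\<close>

lemma gaussian_exponential_integrable:
  "integrable lborel (\<lambda>u::real. exp (c * \<bar>u\<bar>) * exp (- u\<^sup>2 / 2))"
proof (rule Bochner_Integration.integrable_bound)
  have eq: "exp (c * u - u\<^sup>2 / 2) = exp (c\<^sup>2 / 2) * sqrt (2 * pi) * normal_density c 1 u"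
    for c u :: real
    by (simp add: normal_density_def exp_add[symmetric] exp_diff[symmetric]
        power2_eq_square field_simps flip: exp_add)
  have "integrable lborel (\<lambda>u. exp (c * u - u\<^sup>2 / 2))" for c :: real
    unfolding eq by (intro integrable_mult_right) auto
  from Bochner_Integration.integrable_add[OF this[of c] this[of "- c"]]
  show "integrable lborel (\<lambda>u. exp (c * u - u\<^sup>2 / 2) + exp (- c * u - u\<^sup>2 / 2))" .
  show "AE u in lborel. norm (exp (c * \<bar>u\<bar>) * exp (- u\<^sup>2 / 2))
      \<le> norm (exp (c * u - u\<^sup>2 / 2) + exp (- c * u - u\<^sup>2 / 2))"
  proof (rule AE_I2)
    fix u :: real
    show "norm (exp (c * \<bar>u\<bar>) * exp (- u\<^sup>2 / 2))
        \<le> norm (exp (c * u - u\<^sup>2 / 2) + exp (- c * u - u\<^sup>2 / 2))"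
      by (cases "0 \<le> u") (simp_all add: abs_of_nonneg[OF add_nonneg_nonneg] flip: exp_add)
  qed
qed simp

section \<open>Bounds on the risk at a single point\<close>

definition point_risk :: "real \<Rightarrow> real \<Rightarrow> real \<Rightarrow> real" where
  "point_risk p \<tau> m = (\<integral>z. (eta p (m + z) \<tau> - m)\<^sup>2 \<partial>std_normal_distribution)"

lemma two_point_risk_eq:
  "two_point_risk p \<epsilon> m \<tau> = (1 - \<epsilon>) * point_risk p \<tau> 0 + \<epsilon> * point_risk p \<tau> m"
  by (simp add: two_point_risk_def point_risk_def)

lemma point_risk_nonneg: "0 \<le> point_risk p \<tau> m"
  unfolding point_risk_def by simp

context
  fixes p \<tau> :: real
  assumes p: "0 \<le> p" "p < 1" and \<tau>: "0 \<le> \<tau>"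
begin

lemma borel_measurable_eta' [measurable]: "(\<lambda>u. eta p u \<tau>) \<in> borel_measurable borel"
  using borel_measurable_eta[OF p \<tau>] .

text \<open>This majorant does not involve the threshold and serves bounded m;
  \<open>point_risk_integrand_le'\<close> does not involve m and serves the limit of large m and
  arbitrary laws.\<close>

lemma point_risk_integrand_le: "(eta p (m + z) \<tau> - m)\<^sup>2 \<le> (2 * \<bar>m\<bar> + \<bar>z\<bar>)\<^sup>2"
proof -
  have "\<bar>eta p (m + z) \<tau> - m\<bar> \<le> \<bar>2 * \<bar>m\<bar> + \<bar>z\<bar>\<bar>"
    using eta_abs_le[OF p \<tau>, of "m + z"] by linarith
  then show ?thesis by (simp only: abs_le_square_iff)
qed

lemma point_risk_integrand_le': "(eta p (m + z) \<tau> - m)\<^sup>2 \<le> ((1 + 2 * \<tau>) + \<bar>z\<bar>)\<^sup>2"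
proof -
  have "\<bar>eta p (m + z) \<tau> - m\<bar> \<le> \<bar>(1 + 2 * \<tau>) + \<bar>z\<bar>\<bar>"
    using eta_shrinkage_bounded[OF p \<tau>, of "m + z"] by linarith
  then show ?thesis by (simp only: abs_le_square_iff)
qed

lemma point_risk_integrable:
  "integrable std_normal_distribution (\<lambda>z. (eta p (m + z) \<tau> - m)\<^sup>2)"
  by (rule Bochner_Integration.integrable_bound[OF std_normal_integrable_quadratic[of "2 * \<bar>m\<bar>"]])
    (auto intro!: AE_I2 point_risk_integrand_le)

lemma point_risk_bounded:
  "point_risk p \<tau> m \<le> (\<integral>z. ((1 + 2 * \<tau>) + \<bar>z\<bar>)\<^sup>2 \<partial>std_normal_distribution)"
  unfolding point_risk_def
  by (intro integral_mono point_risk_integrable std_normal_integrable_quadratic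
      point_risk_integrand_le')

lemma point_risk_uminus: "point_risk p \<tau> (- m) = point_risk p \<tau> m"
proof -
  have "point_risk p \<tau> (- m)
      = (\<integral>z. (eta p (- m + - z) \<tau> - - m)\<^sup>2 \<partial>std_normal_distribution)"
    unfolding point_risk_def
    by (rule std_normal_integral_uminus[symmetric]) measurable
  also have "(\<lambda>z. (eta p (- m + - z) \<tau> - - m)\<^sup>2) = (\<lambda>z. (eta p (m + z) \<tau> - m)\<^sup>2)"
    using eta_minus[of p "m + _" \<tau>] by (simp add: fun_eq_iff power2_commute)
  finally show ?thesis by (simp add: point_risk_def)
qed

lemma point_risk_abs: "point_risk p \<tau> \<bar>m\<bar> = point_risk p \<tau> m"
  by (simp add: abs_if point_risk_uminus)

lemma point_risk_at_top: "(point_risk p \<tau> \<longlongrightarrow> 1) at_top"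
proof -
  have "((\<lambda>m. \<integral>z. (eta p (m + z) \<tau> - m)\<^sup>2 \<partial>std_normal_distribution)
      \<longlongrightarrow> (\<integral>z. z\<^sup>2 \<partial>std_normal_distribution)) at_top"
  proof (rule integral_dominated_convergence_at_top)
    show "integrable std_normal_distribution (\<lambda>z. ((1 + 2 * \<tau>) + \<bar>z\<bar>)\<^sup>2)"
      by (rule std_normal_integrable_quadratic)
    show "AE z in std_normal_distribution.
        ((\<lambda>m. (eta p (m + z) \<tau> - m)\<^sup>2) \<longlongrightarrow> z\<^sup>2) at_top"
    proof (rule AE_I2)
      fix z
      have "filterlim (\<lambda>m::real. m + z) at_top at_top"
        by real_asymp
      from filterlim_compose[OF eta_asymptotic[OF p \<tau>] this]
      have "((\<lambda>m. (eta p (m + z) \<tau> - (m + z) + z)\<^sup>2) \<longlongrightarrow> (0 + z)\<^sup>2) at_top"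
        by (intro tendsto_intros)
      then show "((\<lambda>m. (eta p (m + z) \<tau> - m)\<^sup>2) \<longlongrightarrow> z\<^sup>2) at_top"
        by (simp add: algebra_simps)
    qed
    show "\<forall>\<^sub>F m in at_top. AE z in std_normal_distribution.
        norm ((eta p (m + z) \<tau> - m)\<^sup>2) \<le> ((1 + 2 * \<tau>) + \<bar>z\<bar>)\<^sup>2"
      using point_risk_integrand_le' by simp
  qed measurable
  then show ?thesis by (simp add: point_risk_def[abs_def] std_normal_integral_sq)
qed

text \<open>Pairing z with -z and using that eta is expansive above its threshold gives at least
  half of (2z)^2.\<close>

lemma point_risk_ge_truncated_second_moment:
  assumes "0 < eta p (m - K) \<tau>"
  shows "(\<integral>z. z\<^sup>2 * indicator {-K..K} z \<partial>std_normal_distribution) \<le> point_risk p \<tau> m"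
proof -
  let ?g = "\<lambda>z. (eta p (m + z) \<tau> - m)\<^sup>2"
  have int: "integrable std_normal_distribution ?g"
    "integrable std_normal_distribution (\<lambda>z. ?g (- z))"
    using point_risk_integrable std_normal_integrable_uminus[OF point_risk_integrable] by auto
  have "integrable std_normal_distribution (\<lambda>z. z\<^sup>2 * indicator {-K..K} z)"
    using std_normal_integrable_sq by (intro integrable_real_mult_indicator) auto
  then have "(\<integral>z. 2 * (z\<^sup>2 * indicator {-K..K} z) \<partial>std_normal_distribution)
      \<le> (\<integral>z. ?g z + ?g (- z) \<partial>std_normal_distribution)"
  proof (intro integral_mono)
    fix z :: real
    show "2 * (z\<^sup>2 * indicator {-K..K} z) \<le> ?g z + ?g (- z)"
    proof (cases "z \<in> {-K..K}")
      case True
      then have "eta p (m - K) \<tau> \<le> eta p (m - \<bar>z\<bar>) \<tau>"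
        by (intro eta_mono p \<tau>) auto
      then have "0 < eta p (m - \<bar>z\<bar>) \<tau>"
        using assms by simp
      then have "2 * \<bar>z\<bar> \<le> eta p (m + \<bar>z\<bar>) \<tau> - eta p (m - \<bar>z\<bar>) \<tau>"
        using eta_expansive[OF p \<tau>, of "m - \<bar>z\<bar>" "m + \<bar>z\<bar>"] by simp
      then have "(2 * \<bar>z\<bar>)\<^sup>2 \<le> (eta p (m + \<bar>z\<bar>) \<tau> - eta p (m - \<bar>z\<bar>) \<tau>)\<^sup>2"
        by (intro power_mono) auto
      also have "\<dots> \<le> 2 * ?g \<bar>z\<bar> + 2 * ?g (- \<bar>z\<bar>)"
        using sum_squares_ge_zero[of "eta p (m + \<bar>z\<bar>) \<tau> + eta p (m - \<bar>z\<bar>) \<tau> - 2 * m" 0]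
        by (simp add: power2_eq_square algebra_simps)
      also have "\<dots> = 2 * (?g z + ?g (- z))"
        by (simp add: abs_if)
      finally show ?thesis using True by (simp add: power_mult_distrib)
    qed simp
  qed (use int in auto)
  also have "\<dots> = 2 * point_risk p \<tau> m"
    using int std_normal_integral_uminus[of ?g] by (simp add: point_risk_def)
  finally show ?thesis by simp
qed

text \<open>For z in the strip the observation lies between 0 and m - K, where sign and monotonicity
  force \<open>eta\<close> to be 0, so the loss is the full m^2. \<open>K + 1 \<le> m\<close> keeps
  the observation nonnegative.\<close>

lemma point_risk_ge_dead_zone:
  assumes "eta p (m - K) \<tau> \<le> 0" "0 \<le> K" "K + 1 \<le> m"
  shows "m\<^sup>2 * (\<integral>z. indicat_real {-K - 1..-K} z \<partial>std_normal_distribution) \<le> point_risk p \<tau> m"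
proof -
  have "(\<integral>z. m\<^sup>2 * indicator {-K - 1..-K} z \<partial>std_normal_distribution) \<le> point_risk p \<tau> m"
    unfolding point_risk_def
  proof (intro integral_mono point_risk_integrable)
    fix z :: real
    show "m\<^sup>2 * indicator {-K - 1..-K} z \<le> (eta p (m + z) \<tau> - m)\<^sup>2"
    proof (cases "z \<in> {-K - 1..-K}")
      case True
      then have "eta p (m + z) \<tau> = 0"
        using eta_nonneg[OF p \<tau>, of "m + z"] eta_mono[OF p \<tau>, of "m + z" "m - K"] assms by auto
      then show ?thesis using True by simp
    qed simp
  qed (auto simp: std_normal.emeasure_eq_measure intro!: integrable_real_indicator)
  then show ?thesis by simp
qed

text \<open>A threshold that lets m through must, by expansiveness, also let pure noise z above m
  through with size at least z - m.\<close>

lemma point_risk_zero_ge: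
  assumes "0 < eta p m \<tau>"
  shows "(\<integral>z. (z - m)\<^sup>2 * indicator {m..} z \<partial>std_normal_distribution) \<le> point_risk p \<tau> 0"
  unfolding point_risk_def
proof (rule integral_mono'[OF point_risk_integrable])
  fix z :: real
  show "(z - m)\<^sup>2 * indicator {m..} z \<le> (eta p (0 + z) \<tau> - 0)\<^sup>2"
  proof (cases "m \<le> z")
    case True
    then have "z - m \<le> eta p z \<tau>" using eta_expansive[OF p \<tau> assms] assms by force
    then show ?thesis using True by (auto intro!: power_mono)
  qed simp
qed simp

end

text \<open>The bound must also hold for thresholds growing with m, so the limit at fixed \<tau> is
  not enough. Either m - n survives thresholding and pairing gives a truncated second moment close
  to 1, or a strip of fixed probability is set to 0 at cost m^2.\<close>

lemma point_risk_uniform_lower_bound: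
  assumes p: "0 \<le> p" "p < 1" and "0 < \<kappa>"
  obtains m0 where "0 < m0" "\<And>m \<tau>. m0 \<le> m \<Longrightarrow> 0 \<le> \<tau> \<Longrightarrow> 1 - \<kappa> \<le> point_risk p \<tau> m"
proof -
  have "(\<lambda>n. \<integral>z. z\<^sup>2 * indicator {- real n..real n} z \<partial>std_normal_distribution)
      \<longlonglongrightarrow> (\<integral>z. z\<^sup>2 \<partial>std_normal_distribution)"
  proof (rule integral_dominated_convergence[where w = "\<lambda>z. z\<^sup>2"])
    show "AE z in std_normal_distribution. (\<lambda>n. z\<^sup>2 * indicator {- real n..real n} z) \<longlonglongrightarrow> z\<^sup>2"
    proof (rule AE_I2)
      fix z :: real
      obtain N where "\<bar>z\<bar> \<le> real N" using real_arch_simple by blast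
      then have "\<forall>\<^sub>F n in sequentially. z\<^sup>2 * indicator {- real n..real n} z = z\<^sup>2"
        by (intro eventually_sequentiallyI[of N]) (auto simp: indicator_def)
      then show "(\<lambda>n. z\<^sup>2 * indicator {- real n..real n} z) \<longlonglongrightarrow> z\<^sup>2"
        by (rule tendsto_eventually)
    qed
  qed (auto simp: std_normal_integrable_sq indicator_def)
  then have "\<forall>\<^sub>F n in sequentially. 1 - \<kappa>
      < (\<integral>z. z\<^sup>2 * indicator {- real n..real n} z \<partial>std_normal_distribution)"
    using \<open>0 < \<kappa>\<close> by (intro order_tendstoD(1)) (auto simp: std_normal_integral_sq)
  then obtain n :: nat where n: "1 - \<kappa>
      < (\<integral>z. z\<^sup>2 * indicator {- real n..real n} z \<partial>std_normal_distribution)"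
    by (auto simp: eventually_sequentially)
  define c where "c = (\<integral>z. indicat_real {- real n - 1..- real n} z \<partial>std_normal_distribution)"
  have "0 < c"
    unfolding c_def by (rule std_normal_integral_pos[of _ "- real n - 1" "- real n"])
      (auto simp: std_normal.emeasure_eq_measure intro!: integrable_real_indicator)
  \<comment> \<open>The term n + 1 keeps the strip, shifted by m, to the right of 0; the term 1 / c
    together with m \<ge> 1 makes m^2 c at least 1.\<close>
  define m0 where "m0 = real n + 1 + 1 / c"
  have "1 - \<kappa> \<le> point_risk p \<tau> m" if "m0 \<le> m" "0 \<le> \<tau>" for m \<tau>
  proof (cases "0 < eta p (m - real n) \<tau>")
    case True
    then show ?thesis
      using point_risk_ge_truncated_second_moment[OF p that(2) True] n by simp
  next
    case False
    have m: "1 / c \<le> m" "1 \<le> m" "real n + 1 \<le> m"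
      using that(1) \<open>0 < c\<close> by (auto simp: m0_def add_increasing add_increasing2 intro: order_trans[rotated])
    have "1 \<le> m * c" using m(1) \<open>0 < c\<close> by (simp add: field_simps)
    also have "\<dots> \<le> m\<^sup>2 * c"
      using m(2) \<open>0 < c\<close> by (intro mult_right_mono) (auto simp: power2_eq_square)
    also have "\<dots> \<le> point_risk p \<tau> m"
      unfolding c_def using False m by (intro point_risk_ge_dead_zone p that) auto
    finally show ?thesis using \<open>0 < \<kappa>\<close> by simp
  qed
  moreover have "0 < m0" using \<open>0 < c\<close> by (simp add: m0_def add_pos_pos)
  ultimately show ?thesis using that by blast
qed

text \<open>Each fixed observation is eventually set to 0, leaving the squared signal. With m = 0
  this silences the origin; with small m it bounds the risk at high noise.\<close>

lemma point_risk_large_threshold: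
  assumes p: "0 \<le> p" "p < 1"
  shows "(\<lambda>n. point_risk p (real n) m) \<longlonglongrightarrow> m\<^sup>2"
proof -
  have "(\<lambda>n. \<integral>z. (eta p (m + z) (real n) - m)\<^sup>2 \<partial>std_normal_distribution)
      \<longlonglongrightarrow> (\<integral>z. m\<^sup>2 \<partial>std_normal_distribution)"
  proof (rule integral_dominated_convergence[where w = "\<lambda>z. (2 * \<bar>m\<bar> + \<bar>z\<bar>)\<^sup>2"])
    show "AE z in std_normal_distribution. (\<lambda>n. (eta p (m + z) (real n) - m)\<^sup>2) \<longlonglongrightarrow> m\<^sup>2"
    proof (rule AE_I2)
      fix z :: real
      obtain N where N: "\<bar>m + z\<bar> powr (2 - p) < real N" using reals_Archimedean2 by blast
      have "(eta p (m + z) (real n) - m)\<^sup>2 = m\<^sup>2" if "N \<le> n" for n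
      proof -
        have "\<bar>m + z\<bar> powr (2 - p) < real n" using N that by linarith
        then show ?thesis using eta_eq_0[OF p] by simp
      qed
      then show "(\<lambda>n. (eta p (m + z) (real n) - m)\<^sup>2) \<longlonglongrightarrow> m\<^sup>2"
        by (intro tendsto_eventually eventually_sequentiallyI)
    qed
    show "integrable std_normal_distribution (\<lambda>z. (2 * \<bar>m\<bar> + \<bar>z\<bar>)\<^sup>2)"
      by (rule std_normal_integrable_quadratic)
    show "AE z in std_normal_distribution.
        norm ((eta p (m + z) (real n) - m)\<^sup>2) \<le> (2 * \<bar>m\<bar> + \<bar>z\<bar>)\<^sup>2" for n
      using point_risk_integrand_le[OF p] by simp
    show "(\<lambda>z. (eta p (m + z) (real n) - m)\<^sup>2) \<in> borel_measurable std_normal_distribution" for n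
      using borel_measurable_integrable[OF point_risk_integrable[OF p]] by simp
  qed simp
  then show ?thesis using std_normal.prob_space by (simp add: point_risk_def)
qed

section \<open>Regularity of the risk and the scaling of state evolution\<close>

text \<open>Substituting u = m + z takes m out of the possibly discontinuous \<open>eta\<close> and
  puts it into the Gaussian factor, where derivatives in m exist for every threshold.\<close>

lemma point_risk_lborel:
  assumes p: "0 \<le> p" "p < 1" and \<tau>: "0 \<le> \<tau>"
  shows "point_risk p \<tau> m
    = (\<integral>u. (eta p u \<tau> - m)\<^sup>2 * exp (- (u - m)\<^sup>2 / 2) \<partial>lborel) / sqrt (2 * pi)"
    (is "?P = ?Q")
    and "integrable lborel (\<lambda>u. (eta p u \<tau> - m)\<^sup>2 * exp (- (u - m)\<^sup>2 / 2))"
proof -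
  note [measurable] = borel_measurable_eta'[OF p \<tau>]
  let ?f = "\<lambda>u. (eta p u \<tau> - m)\<^sup>2 * exp (- (u - m)\<^sup>2 / 2)"
  have eq: "std_normal_density z * (eta p (m + z) \<tau> - m)\<^sup>2 = 1 / sqrt (2 * pi) * ?f (m + 1 * z)" for z
    by (simp add: normal_density_def)
  have "?P = (\<integral>z. std_normal_density z * (eta p (m + z) \<tau> - m)\<^sup>2 \<partial>lborel)"
    unfolding point_risk_def by (subst integral_density) auto
  also have "\<dots> = (\<integral>z. ?f (m + 1 * z) \<partial>lborel) / sqrt (2 * pi)"
    unfolding eq by simp
  also have "(\<integral>z. ?f (m + 1 * z) \<partial>lborel) = (\<integral>u. ?f u \<partial>lborel)"
    by (subst lborel_integral_real_affine[of 1 ?f m]) auto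
  finally show "?P = ?Q" .
  have "integrable lborel (\<lambda>z. std_normal_density z * (eta p (m + z) \<tau> - m)\<^sup>2)"
    using point_risk_integrable[OF p \<tau>, of m] by (subst (asm) integrable_density) auto
  then have "integrable lborel
      (\<lambda>z. sqrt (2 * pi) * (std_normal_density z * (eta p (m + z) \<tau> - m)\<^sup>2))"
    by (rule integrable_mult_right)
  then have "integrable lborel (\<lambda>z. ?f (m + 1 * z))"
    unfolding eq by simp
  then show "integrable lborel ?f"
    by (subst (asm) lborel_integrable_real_affine_iff) auto
qed

lemma point_risk_kernel_deriv:
  "((\<lambda>m. (x - m)\<^sup>2 * exp (- (u - m)\<^sup>2 / 2)) has_real_derivative
     (- 2 * (x - m) + (x - m)\<^sup>2 * (u - m)) * exp (- (u - m)\<^sup>2 / 2)) (at m)"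
  "((\<lambda>m. (- 2 * (x - m) + (x - m)\<^sup>2 * (u - m)) * exp (- (u - m)\<^sup>2 / 2)) has_real_derivative
     (2 - 4 * (x - m) * (u - m) + (x - m)\<^sup>2 * ((u - m)\<^sup>2 - 1)) * exp (- (u - m)\<^sup>2 / 2)) (at m)"
proof -
  \<comment> \<open>Naming the Gaussian factor keeps it folded, so that only polynomial identities
    remain.\<close>
  define e where "e = (\<lambda>m. exp (- (u - m)\<^sup>2 / 2))"
  have e: "(e has_real_derivative (u - m) * e m) (at m)"
    unfolding e_def by (auto intro!: derivative_eq_intros simp: field_simps)
  show "((\<lambda>m. (x - m)\<^sup>2 * exp (- (u - m)\<^sup>2 / 2)) has_real_derivative
     (- 2 * (x - m) + (x - m)\<^sup>2 * (u - m)) * exp (- (u - m)\<^sup>2 / 2)) (at m)"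
    unfolding e_def[THEN fun_cong, symmetric]
    by (auto intro!: derivative_eq_intros e simp: algebra_simps)
  show "((\<lambda>m. (- 2 * (x - m) + (x - m)\<^sup>2 * (u - m)) * exp (- (u - m)\<^sup>2 / 2)) has_real_derivative
     (2 - 4 * (x - m) * (u - m) + (x - m)\<^sup>2 * ((u - m)\<^sup>2 - 1)) * exp (- (u - m)\<^sup>2 / 2)) (at m)"
    unfolding e_def[THEN fun_cong, symmetric]
    by (auto intro!: derivative_eq_intros e simp: power2_eq_square algebra_simps)
qed

text \<open>Here x stands for \<open>eta p u \<tau>\<close>, of which only |x| \<le> |u| is known;
  the majorant depends on u and B alone, hence not on the threshold. It is 4 exp (2 y) exp (B |u|)
  exp (- u^2 / 2) with y = |u| + B.\<close>

lemma point_risk_kernel_bounds: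
  fixes x u m B :: real
  assumes "\<bar>x\<bar> \<le> \<bar>u\<bar>" "\<bar>m\<bar> \<le> B"
  defines "W \<equiv> 4 * exp (2 * B) * (exp ((B + 2) * \<bar>u\<bar>) * exp (- u\<^sup>2 / 2))"
  shows "\<bar>(- 2 * (x - m) + (x - m)\<^sup>2 * (u - m)) * exp (- (u - m)\<^sup>2 / 2)\<bar> \<le> W"
    and "\<bar>(2 - 4 * (x - m) * (u - m) + (x - m)\<^sup>2 * ((u - m)\<^sup>2 - 1)) * exp (- (u - m)\<^sup>2 / 2)\<bar> \<le> W"
proof -
  define y where "y = \<bar>u\<bar> + B"
  have y: "0 \<le> y" "\<bar>x - m\<bar> \<le> y" "\<bar>u - m\<bar> \<le> y" using assms by (auto simp: y_def)
  have "u * m \<le> \<bar>u\<bar> * B"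
    using assms by (metis abs_ge_self abs_ge_zero abs_mult mult_left_mono order_trans)
  then have "- (u - m)\<^sup>2 / 2 \<le> B * \<bar>u\<bar> + - u\<^sup>2 / 2"
    by (simp add: power2_eq_square field_simps add_increasing)
  then have e: "exp (- (u - m)\<^sup>2 / 2) \<le> exp (B * \<bar>u\<bar>) * exp (- u\<^sup>2 / 2)"
    by (simp flip: exp_add)
  \<comment> \<open>Squaring the Taylor bound puts a polynomial of degree 4 below exp (2 y), enough
    for the quartic factor in the second derivative.\<close>
  have "(1 + y + y\<^sup>2 / 2)\<^sup>2 \<le> (exp y)\<^sup>2"
    using y exp_lower_Taylor_quadratic[of y] by (intro power_mono) auto
  then have "1 + 2 * y + 2 * y\<^sup>2 + y ^ 3 + y ^ 4 / 4 \<le> exp (2 * y)"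
    unfolding exp_double
    by (simp add: power2_eq_square power3_eq_cube power4_eq_xxxx field_simps)
  then have Y: "4 + 8 * y + 8 * y\<^sup>2 + 4 * y ^ 3 + y ^ 4 \<le> 4 * exp (2 * y)" by simp
  have poly: "2 * y + y ^ 3 \<le> 4 * exp (2 * y)" "2 + 5 * y\<^sup>2 + y ^ 4 \<le> 4 * exp (2 * y)"
    using Y y(1) zero_le_power[OF y(1), of 2] zero_le_power[OF y(1), of 3]
      zero_le_power[OF y(1), of 4] by linarith+
  have W: "4 * exp (2 * y) * (exp (B * \<bar>u\<bar>) * exp (- u\<^sup>2 / 2)) = W"
    unfolding W_def y_def by (simp add: algebra_simps flip: exp_add)
  have sq: "(x - m)\<^sup>2 \<le> y\<^sup>2" "(u - m)\<^sup>2 \<le> y\<^sup>2"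
    using y by (auto simp: abs_le_square_iff[symmetric])
  have abs_sq: "\<bar>(u - m)\<^sup>2 - 1\<bar> \<le> y\<^sup>2 + 1"
    using sq(2) zero_le_power2[of "u - m"] by linarith
  have "\<bar>- 2 * (x - m) + (x - m)\<^sup>2 * (u - m)\<bar> \<le> 2 * \<bar>x - m\<bar> + (x - m)\<^sup>2 * \<bar>u - m\<bar>"
    by (rule order_trans[OF abs_triangle_ineq])
      (simp only: abs_mult abs_neg_numeral abs_power2 order_refl)
  also have "\<dots> \<le> 2 * y + y\<^sup>2 * y"
    using y sq by (intro add_mono mult_mono) auto
  also have "\<dots> \<le> 4 * exp (2 * y)"
    using poly(1) by (simp add: power2_eq_square power3_eq_cube)
  finally show "\<bar>(- 2 * (x - m) + (x - m)\<^sup>2 * (u - m)) * exp (- (u - m)\<^sup>2 / 2)\<bar> \<le> W"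
    unfolding abs_mult W[symmetric] using e by (intro mult_mono) auto
  have "\<bar>2 - 4 * (x - m) * (u - m) + (x - m)\<^sup>2 * ((u - m)\<^sup>2 - 1)\<bar>
      \<le> \<bar>2 :: real\<bar> + \<bar>4 * (x - m) * (u - m)\<bar> + \<bar>(x - m)\<^sup>2 * ((u - m)\<^sup>2 - 1)\<bar>"
    by linarith
  also have "\<dots> = 2 + 4 * (\<bar>x - m\<bar> * \<bar>u - m\<bar>) + (x - m)\<^sup>2 * \<bar>(u - m)\<^sup>2 - 1\<bar>"
    by (simp only: abs_mult abs_numeral abs_power2 mult.assoc)
  also have "\<dots> \<le> 2 + 4 * (y * y) + y\<^sup>2 * (y\<^sup>2 + 1)"
    using y sq abs_sq by (intro add_mono mult_mono order_refl) auto
  also have "\<dots> \<le> 4 * exp (2 * y)"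
    using poly(2) by (simp add: power2_eq_square power4_eq_xxxx algebra_simps)
  finally show "\<bar>(2 - 4 * (x - m) * (u - m) + (x - m)\<^sup>2 * ((u - m)\<^sup>2 - 1)) * exp (- (u - m)\<^sup>2 / 2)\<bar> \<le> W"
    unfolding abs_mult W[symmetric] using e by (intro mult_mono) auto
qed

text \<open>The kernel estimates are integrated over u. That C does not depend on \<tau> is what
  survives taking an infimum over thresholds. The factor in the witness \<open>2 * I\<close> comes
  from the second difference.\<close>

lemma point_risk_regular:
  assumes p: "0 \<le> p" "p < 1"
  obtains C where "0 \<le> C"
    and "\<And>\<tau> m n. 0 \<le> \<tau> \<Longrightarrow> \<bar>m\<bar> \<le> B \<Longrightarrow> \<bar>n\<bar> \<le> B \<Longrightarrow>
      \<bar>point_risk p \<tau> m - point_risk p \<tau> n\<bar> \<le> C * \<bar>m - n\<bar>"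
    and "\<And>\<tau> m h. 0 \<le> \<tau> \<Longrightarrow> 0 \<le> h \<Longrightarrow> \<bar>m\<bar> + h \<le> B \<Longrightarrow>
      point_risk p \<tau> (m + h) + point_risk p \<tau> (m - h) - 2 * point_risk p \<tau> m \<le> C * h\<^sup>2"
proof -
  define W where "W = (\<lambda>u::real. 4 * exp (2 * B) * (exp ((B + 2) * \<bar>u\<bar>) * exp (- u\<^sup>2 / 2)))"
  have W: "integrable lborel W" "0 \<le> W u" for u
    unfolding W_def using gaussian_exponential_integrable[of "B + 2"] by auto
  define I where "I = (\<integral>u. W u \<partial>lborel) / sqrt (2 * pi)"
  have "0 \<le> I" unfolding I_def using W by simp
  have lip: "point_risk p \<tau> m - point_risk p \<tau> n \<le> I * \<bar>m - n\<bar>"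
    if \<tau>: "0 \<le> \<tau>" and mn: "\<bar>m\<bar> \<le> B" "\<bar>n\<bar> \<le> B" for \<tau> m n
  proof -
    let ?g = "\<lambda>u m. (eta p u \<tau> - m)\<^sup>2 * exp (- (u - m)\<^sup>2 / 2)"
    have "(\<integral>u. ?g u m - ?g u n \<partial>lborel) \<le> (\<integral>u. W u * \<bar>m - n\<bar> \<partial>lborel)"
    proof (rule integral_mono)
      fix u :: real
      have "norm (?g u m - ?g u n) \<le> W u * norm (m - n)"
        unfolding W_def
      proof (rule field_differentiable_bound[where S = "{- B..B}"])
        fix z :: real assume "z \<in> {- B..B}"
        then show "norm ((- 2 * (eta p u \<tau> - z) + (eta p u \<tau> - z)\<^sup>2 * (u - z)) * exp (- (u - z)\<^sup>2 / 2))
            \<le> 4 * exp (2 * B) * (exp ((B + 2) * \<bar>u\<bar>) * exp (- u\<^sup>2 / 2))"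
          unfolding real_norm_def
          using eta_abs_le[OF p \<tau>] by (intro point_risk_kernel_bounds(1)) auto
        show "((\<lambda>m. ?g u m) has_field_derivative
            (- 2 * (eta p u \<tau> - z) + (eta p u \<tau> - z)\<^sup>2 * (u - z)) * exp (- (u - z)\<^sup>2 / 2))
            (at z within {- B..B})"
          by (rule has_field_derivative_at_within[OF point_risk_kernel_deriv(1)])
      qed (use mn in auto)
      then show "?g u m - ?g u n \<le> W u * \<bar>m - n\<bar>" by simp
    qed (use point_risk_lborel(2)[OF p \<tau>] W in auto)
    then have "(\<integral>u. ?g u m \<partial>lborel) - (\<integral>u. ?g u n \<partial>lborel)
        \<le> (\<integral>u. W u \<partial>lborel) * \<bar>m - n\<bar>"
      using point_risk_lborel(2)[OF p \<tau>] by simp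
    then show ?thesis
      unfolding point_risk_lborel(1)[OF p \<tau>] I_def
      by (simp add: divide_right_mono flip: diff_divide_distrib)
  qed
  have snd: "point_risk p \<tau> (m + h) + point_risk p \<tau> (m - h) - 2 * point_risk p \<tau> m
      \<le> 2 * I * h\<^sup>2" if \<tau>: "0 \<le> \<tau>" and h: "0 \<le> h" "\<bar>m\<bar> + h \<le> B" for \<tau> m h
  proof -
    let ?g = "\<lambda>u m. (eta p u \<tau> - m)\<^sup>2 * exp (- (u - m)\<^sup>2 / 2)"
    have "(\<integral>u. ?g u (m + h) + ?g u (m - h) - 2 * ?g u m \<partial>lborel) \<le> (\<integral>u. W u * (2 * h\<^sup>2) \<partial>lborel)"
    proof (rule integral_mono)
      fix u :: real
      show "?g u (m + h) + ?g u (m - h) - 2 * ?g u m \<le> W u * (2 * h\<^sup>2)"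
        unfolding W_def
      proof (rule second_difference_bound[OF point_risk_kernel_deriv])
        fix z assume "m - h \<le> z" "z \<le> m + h"
        then have "\<bar>z\<bar> \<le> B" using h by linarith
        then show "\<bar>(2 - 4 * (eta p u \<tau> - z) * (u - z) + (eta p u \<tau> - z)\<^sup>2 * ((u - z)\<^sup>2 - 1))
            * exp (- (u - z)\<^sup>2 / 2)\<bar>
            \<le> 4 * exp (2 * B) * (exp ((B + 2) * \<bar>u\<bar>) * exp (- u\<^sup>2 / 2))"
          using eta_abs_le[OF p \<tau>] by (intro point_risk_kernel_bounds(2)) auto
      qed (use h in auto)
    qed (use point_risk_lborel(2)[OF p \<tau>] W in auto)
    then have "(\<integral>u. ?g u (m + h) \<partial>lborel) + (\<integral>u. ?g u (m - h) \<partial>lborel)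
        - 2 * (\<integral>u. ?g u m \<partial>lborel) \<le> (\<integral>u. W u \<partial>lborel) * (2 * h\<^sup>2)"
      using point_risk_lborel(2)[OF p \<tau>] by simp
    from divide_right_mono[OF this, of "sqrt (2 * pi)"]
    show ?thesis
      unfolding point_risk_lborel(1)[OF p \<tau>] I_def
      by (simp add: diff_divide_distrib add_divide_distrib mult_ac)
  qed
  show ?thesis
  proof
    show "0 \<le> 2 * I" using \<open>0 \<le> I\<close> by simp
    fix \<tau> m n :: real assume *: "0 \<le> \<tau>" "\<bar>m\<bar> \<le> B" "\<bar>n\<bar> \<le> B"
    have "\<bar>point_risk p \<tau> m - point_risk p \<tau> n\<bar> \<le> I * \<bar>m - n\<bar>"
      using lip[OF *] lip[OF *(1,3,2)] by (simp add: abs_le_iff abs_minus_commute)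
    also have "\<dots> \<le> 2 * I * \<bar>m - n\<bar>"
      using \<open>0 \<le> I\<close> by (intro mult_right_mono) auto
    finally show "\<bar>point_risk p \<tau> m - point_risk p \<tau> n\<bar> \<le> 2 * I * \<bar>m - n\<bar>" .
  qed (rule snd)
qed

lemma point_risk_borel_measurable [measurable]:
  assumes p: "0 \<le> p" "p < 1" and \<tau>: "0 \<le> \<tau>"
  shows "point_risk p \<tau> \<in> borel_measurable borel"
proof -
  note [measurable] = borel_measurable_eta'[OF p \<tau>]
  show ?thesis unfolding point_risk_def[abs_def] by measurable
qed

section \<open>Averaging over a law and rescaling by sigma\<close>

definition averaged_risk :: "real \<Rightarrow> real measure \<Rightarrow> real \<Rightarrow> real \<Rightarrow> real" where
  "averaged_risk p M \<tau> v = (\<integral>x. point_risk p \<tau> (x * v) \<partial>M)"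

lemma averaged_risk_nonneg: "0 \<le> averaged_risk p M \<tau> v"
  unfolding averaged_risk_def by (simp add: point_risk_nonneg)

text \<open>The argument v is 1 / sigma, so small v means high noise. For sigma > 0 and no
  measurement noise this is \<delta> times the ratio of \<open>state_evolution\<close> to
  sigma^2.\<close>

definition normalized_risk :: "real \<Rightarrow> real measure \<Rightarrow> real \<Rightarrow> real" where
  "normalized_risk p M v = (INF \<tau>\<in>{0..}. averaged_risk p M \<tau> v)"

lemma averaged_risk_bdd_below: "bdd_below ((\<lambda>\<tau>. averaged_risk p M \<tau> v) ` {0..})"
  by (rule bdd_belowI2[of _ 0]) (simp add: averaged_risk_nonneg)

lemma normalized_risk_le: "0 \<le> \<tau> \<Longrightarrow> normalized_risk p M v \<le> averaged_risk p M \<tau> v"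
  unfolding normalized_risk_def by (intro cINF_lower averaged_risk_bdd_below) auto

context
  fixes p :: real and M :: "real measure"
  assumes p: "0 \<le> p" "p < 1" and M: "real_distribution M"
begin

lemma point_risk_integrable_distribution:
  assumes \<tau>: "0 \<le> \<tau>"
  shows "integrable M (\<lambda>x. point_risk p \<tau> (x * v))"
proof -
  interpret real_distribution M by fact
  note [measurable] = point_risk_borel_measurable[OF p \<tau>]
  show ?thesis
    by (rule integrable_const_bound) (use point_risk_bounded[OF p \<tau>] in \<open>auto simp: point_risk_nonneg\<close>)
qed

lemma thresholding_risk_eq:
  assumes \<tau>: "0 \<le> \<tau>" and "0 < \<sigma>"
  shows "thresholding_risk p M \<sigma> (\<sigma> powr (2 - p) * \<tau>) = \<sigma>\<^sup>2 * averaged_risk p M \<tau> (1 / \<sigma>)"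
proof -
  interpret M: real_distribution M by fact
  interpret pair_sigma_finite M std_normal_distribution ..
  note [measurable] = borel_measurable_eta'[OF p \<tau>]
  let ?f = "\<lambda>(x, z). (eta p (x / \<sigma> + z) \<tau> - x / \<sigma>)\<^sup>2"
  have [measurable]: "?f \<in> borel_measurable (M \<Otimes>\<^sub>M std_normal_distribution)"
    by measurable
  have eq: "(eta p (x + \<sigma> * z) (\<sigma> powr (2 - p) * \<tau>) - x)\<^sup>2 = \<sigma>\<^sup>2 * ?f (x, z)" for x z
    using eta_scale[of \<sigma> p "x / \<sigma> + z" \<tau>] \<open>0 < \<sigma>\<close>
    by (simp add: algebra_simps power_mult_distrib[symmetric])
  have "integrable (M \<Otimes>\<^sub>M std_normal_distribution) ?f"
  proof (rule Fubini_integrable)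
    show "integrable M (\<lambda>x. \<integral>z. norm (?f (x, z)) \<partial>std_normal_distribution)"
      using point_risk_integrable_distribution[OF \<tau>, of "1 / \<sigma>"] by (simp add: point_risk_def)
    show "AE x in M. integrable std_normal_distribution (\<lambda>z. ?f (x, z))"
      using point_risk_integrable[OF p \<tau>] by simp
  qed simp
  then have "(\<integral>x. \<integral>z. ?f (x, z) \<partial>std_normal_distribution \<partial>M)
      = integral\<^sup>L (M \<Otimes>\<^sub>M std_normal_distribution) ?f"
    by (rule integral_fst')
  then have "averaged_risk p M \<tau> (1 / \<sigma>) = integral\<^sup>L (M \<Otimes>\<^sub>M std_normal_distribution) ?f"
    by (simp add: averaged_risk_def point_risk_def)
  moreover have "thresholding_risk p M \<sigma> (\<sigma> powr (2 - p) * \<tau>)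
      = (\<integral>xz. \<sigma>\<^sup>2 * ?f xz \<partial>(M \<Otimes>\<^sub>M std_normal_distribution))"
    unfolding thresholding_risk_def eq by (simp add: case_prod_unfold)
  ultimately show ?thesis by simp
qed

text \<open>Multiplication by sigma^(2 - p) maps the nonnegative thresholds onto themselves, so
  optimising over the scaled thresholds gives the same infimum.\<close>

lemma state_evolution_eq:
  assumes "0 < \<sigma>"
  shows "state_evolution p \<delta> 0 M (\<sigma>\<^sup>2) = \<sigma>\<^sup>2 * (normalized_risk p M (1 / \<sigma>) / \<delta>)"
proof -
  have "{0..} = (\<lambda>\<tau>. \<sigma> powr (2 - p) * \<tau>) ` {0::real..}"
  proof (intro equalityI subsetI)
    fix l :: real assume "l \<in> {0..}"
    then show "l \<in> (\<lambda>\<tau>. \<sigma> powr (2 - p) * \<tau>) ` {0::real..}"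
      using assms by (intro image_eqI[of _ _ "l / \<sigma> powr (2 - p)"]) auto
  qed auto
  then have "(INF l\<in>{0..}. thresholding_risk p M \<sigma> l)
      = Inf (thresholding_risk p M \<sigma> ` (\<lambda>\<tau>. \<sigma> powr (2 - p) * \<tau>) ` {0..})" by simp
  also have "\<dots> = (INF \<tau>\<in>{0..}. \<sigma>\<^sup>2 * averaged_risk p M \<tau> (1 / \<sigma>))"
    unfolding image_image using assms by (intro INF_cong refl) (simp add: thresholding_risk_eq)
  also have "\<dots> = \<sigma>\<^sup>2 * normalized_risk p M (1 / \<sigma>)"
  proof -
    have "mono ((*) (\<sigma>\<^sup>2))" by (intro monoI mult_left_mono) auto
    from continuous_at_Inf_mono[OF this _ _ averaged_risk_bdd_below[of p M "1 / \<sigma>"]]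
    show ?thesis
      unfolding normalized_risk_def image_image by (simp add: continuous_intros)
  qed
  finally show ?thesis using assms by (simp add: state_evolution_def)
qed

lemma state_evolution_zero: "state_evolution p \<delta> 0 M 0 = 0"
proof -
  have nonneg: "0 \<le> thresholding_risk p M 0 l" for l
    unfolding thresholding_risk_def by (simp add: case_prod_unfold)
  have "(INF l\<in>{0..}. thresholding_risk p M 0 l) \<le> thresholding_risk p M 0 0"
    by (rule cINF_lower) (auto intro!: bdd_belowI2[of _ 0] nonneg)
  also have "\<dots> = 0"
    using p by (simp add: thresholding_risk_def case_prod_unfold)
  finally have "(INF l\<in>{0..}. thresholding_risk p M 0 l) = 0"
    using nonneg by (intro antisym cINF_greatest) auto
  then show ?thesis by (simp add: state_evolution_def)
qed

lemma state_evolution_cmp: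
  assumes "0 < \<sigma>" "0 < \<delta>"
  shows "state_evolution p \<delta> 0 M (\<sigma>\<^sup>2) < \<sigma>\<^sup>2 \<longleftrightarrow> normalized_risk p M (1 / \<sigma>) < \<delta>"
    and "state_evolution p \<delta> 0 M (\<sigma>\<^sup>2) > \<sigma>\<^sup>2 \<longleftrightarrow> normalized_risk p M (1 / \<sigma>) > \<delta>"
    and "state_evolution p \<delta> 0 M (\<sigma>\<^sup>2) = \<sigma>\<^sup>2 \<longleftrightarrow> normalized_risk p M (1 / \<sigma>) = \<delta>"
proof -
  have "0 < \<sigma>\<^sup>2" using assms by simp
  then show "state_evolution p \<delta> 0 M (\<sigma>\<^sup>2) < \<sigma>\<^sup>2 \<longleftrightarrow> normalized_risk p M (1 / \<sigma>) < \<delta>"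
    "state_evolution p \<delta> 0 M (\<sigma>\<^sup>2) > \<sigma>\<^sup>2 \<longleftrightarrow> normalized_risk p M (1 / \<sigma>) > \<delta>"
    "state_evolution p \<delta> 0 M (\<sigma>\<^sup>2) = \<sigma>\<^sup>2 \<longleftrightarrow> normalized_risk p M (1 / \<sigma>) = \<delta>"
    unfolding state_evolution_eq[OF assms(1)] using assms(2)
    by (auto simp: mult_less_cancel_left1 mult_less_cancel_left2 field_simps)
qed

lemma stable_zeroI:
  assumes "0 < \<delta>" "0 < b" "\<And>s. 0 < s \<Longrightarrow> s < b \<Longrightarrow> normalized_risk p M (1 / s) < \<delta>"
  shows "stable_fixed_point (state_evolution p \<delta> 0 M) 0"
  unfolding stable_fixed_point_def using assms
  by (auto simp: state_evolution_zero state_evolution_cmp intro!: exI[of _ b])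

text \<open>Inversion reverses order, so an upward crossing in v is a stable point in sigma. The
  interval has endpoints 1 / (v + e) and 1 / (v - e), the latter positive because e < v.\<close>

lemma stable_posI:
  assumes "0 < \<delta>" "0 < v" "0 < e" "e < v" "normalized_risk p M v = \<delta>"
    and less: "\<And>w. v - e < w \<Longrightarrow> w < v \<Longrightarrow> normalized_risk p M w < \<delta>"
    and greater: "\<And>w. v < w \<Longrightarrow> w < v + e \<Longrightarrow> \<delta> < normalized_risk p M w"
  shows "stable_fixed_point (state_evolution p \<delta> 0 M) (1 / v)"
proof -
  have "state_evolution p \<delta> 0 M (s\<^sup>2) < s\<^sup>2" if "s \<in> {1 / v<..<1 / (v - e)}" for s
  proof -
    have s: "0 < s" using that assms by (auto intro: less_trans[rotated])
    have "v - e < 1 / s" "1 / s < v" using that s assms by (auto simp: field_simps)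
    then show ?thesis using less s assms by (simp add: state_evolution_cmp)
  qed
  moreover have "state_evolution p \<delta> 0 M (s\<^sup>2) > s\<^sup>2" if "s \<in> {1 / (v + e)<..<1 / v}" for s
  proof -
    have s: "0 < s" using that assms by (auto intro: less_trans[rotated])
    have "v < 1 / s" "1 / s < v + e" using that s assms by (auto simp: field_simps)
    then show ?thesis using greater s assms by (simp add: state_evolution_cmp)
  qed
  moreover have "state_evolution p \<delta> 0 M ((1 / v)\<^sup>2) = (1 / v)\<^sup>2"
    using state_evolution_cmp(3)[of "1 / v" \<delta>] assms by simp
  moreover have "0 \<le> 1 / (v + e)" "1 / (v + e) < 1 / v" "1 / v < 1 / (v - e)" "0 < 1 / v"
    using assms by (auto simp: field_simps)
  ultimately show ?thesis unfolding stable_fixed_point_def by blast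
qed

end

section \<open>Transversal crossings and finitely supported laws\<close>

lemma cINF_le_add:
  fixes F G :: "'i \<Rightarrow> real"
  assumes "I \<noteq> {}" "bdd_below (F ` I)" "\<And>i. i \<in> I \<Longrightarrow> F i \<le> G i + c"
  shows "(INF i\<in>I. F i) \<le> (INF i\<in>I. G i) + c"
proof -
  have "(INF i\<in>I. F i) - c \<le> (INF i\<in>I. G i)"
  proof (rule cINF_greatest)
    fix i assume "i \<in> I"
    then have "(INF i\<in>I. F i) \<le> F i" using assms(2) by (rule cINF_lower[rotated])
    also have "\<dots> \<le> G i + c" using assms(3) \<open>i \<in> I\<close> .
    finally show "(INF i\<in>I. F i) - c \<le> G i" by simp
  qed fact
  then show ?thesis by simp
qed

text \<open>For a fixed weight theta the level delta might be attained tangentially. Let instead theta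
  decrease linearly in v and stop at the last v where the value is at most delta. Right of it the
  value exceeds delta at least linearly, because the far risk B exceeds delta by a margin;
  semiconcavity of the infimum turns this into a strict deficit on the left.\<close>

lemma clean_crossing:
  fixes I :: "'i set" and A B :: "'i \<Rightarrow> real \<Rightarrow> real" and T :: "real \<Rightarrow> real \<Rightarrow> real"
  defines "T \<equiv> \<lambda>\<theta> v. INF i\<in>I. (1 - \<theta>) * A i v + \<theta> * B i v"
  assumes V: "0 < V" "V < 1" and L: "0 \<le> L" and \<theta>0: "0 < \<theta>0" "\<theta>0 \<le> 1"
    and nonneg: "\<And>i v. i \<in> I \<Longrightarrow> 0 \<le> A i v" "\<And>i v. i \<in> I \<Longrightarrow> 0 \<le> B i v"
    and bounded: "\<And>i v. i \<in> I \<Longrightarrow> 0 \<le> v \<Longrightarrow> v \<le> 1 \<Longrightarrow> A i v \<le> L"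
      "\<And>i v. i \<in> I \<Longrightarrow> 0 \<le> v \<Longrightarrow> v \<le> 1 \<Longrightarrow> B i v \<le> L"
    and lipschitz:
      "\<And>i v w. i \<in> I \<Longrightarrow> 0 \<le> v \<Longrightarrow> v \<le> 1 \<Longrightarrow> 0 \<le> w \<Longrightarrow> w \<le> 1 \<Longrightarrow> \<bar>A i v - A i w\<bar> \<le> L * \<bar>v - w\<bar>"
      "\<And>i v w. i \<in> I \<Longrightarrow> 0 \<le> v \<Longrightarrow> v \<le> 1 \<Longrightarrow> 0 \<le> w \<Longrightarrow> w \<le> 1 \<Longrightarrow> \<bar>B i v - B i w\<bar> \<le> L * \<bar>v - w\<bar>"
    and semiconcave:
      "\<And>i v h. i \<in> I \<Longrightarrow> 0 \<le> h \<Longrightarrow> h \<le> v \<Longrightarrow> v + h \<le> 1 \<Longrightarrow> A i (v + h) + A i (v - h) - 2 * A i v \<le> L * h\<^sup>2"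
      "\<And>i v h. i \<in> I \<Longrightarrow> 0 \<le> h \<Longrightarrow> h \<le> v \<Longrightarrow> v + h \<le> 1 \<Longrightarrow> B i (v + h) + B i (v - h) - 2 * B i v \<le> L * h\<^sup>2"
    and far: "\<And>i v. i \<in> I \<Longrightarrow> V \<le> v \<Longrightarrow> v \<le> 1 \<Longrightarrow> \<delta> + 2 * \<iota> \<le> B i v" and \<iota>: "0 < \<iota>"
    and start: "\<delta> < (INF i\<in>I. A i 1)"
    and terminal: "j \<in> I" "(1 - \<theta>0) * A j V + \<theta>0 * B j V < \<delta>"
  obtains \<theta> v e where "0 \<le> \<theta>" "\<theta> \<le> \<theta>0" "0 < e" "e < v" "T \<theta> v = \<delta>"
    "\<And>w. v - e < w \<Longrightarrow> w < v \<Longrightarrow> T \<theta> w < \<delta>"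
    "\<And>w. v < w \<Longrightarrow> w < v + e \<Longrightarrow> \<delta> < T \<theta> w"
proof -
  let ?R = "\<lambda>\<theta> i v. (1 - \<theta>) * A i v + \<theta> * B i v"
  \<comment> \<open>This slope makes \<open>q\<close> equal \<theta>0 at V and 0 at 1, so the
    terminal and the starting hypothesis sit at the two ends.\<close>
  define k where "k = \<theta>0 / (1 - V)"
  define q where "q = (\<lambda>v. k * (1 - v))"
  define f where "f = (\<lambda>v. T (q v) v)"
  have k: "0 < k" using \<theta>0 V by (simp add: k_def)
  have qV: "q V = \<theta>0" using V by (simp add: q_def k_def)
  have q_mono: "q v \<le> q w" if "w \<le> v" for v w
    using k that by (simp add: q_def)
  have q_range: "0 \<le> q v" "q v \<le> \<theta>0" "q v \<le> 1" if "V \<le> v" "v \<le> 1" for v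
    using q_mono[of V v] q_mono[of v 1] that \<theta>0 qV by (auto simp: q_def)
  have I: "I \<noteq> {}" using terminal by auto
  have bdd: "bdd_below ((\<lambda>i. ?R \<theta> i v) ` I)" if "0 \<le> \<theta>" "\<theta> \<le> 1" for \<theta> v
    using nonneg that by (intro bdd_belowI2[of _ 0]) (auto intro!: add_nonneg_nonneg)
  have T_le: "T \<theta> v \<le> ?R \<theta> i v" if "0 \<le> \<theta>" "\<theta> \<le> 1" "i \<in> I" for \<theta> v i
    unfolding T_def using bdd that by (intro cINF_lower) auto

  \<comment> \<open>Moving v changes the risks at rate L and the weight at rate k; the weight
    multiplies B - A, which is at most L in size.\<close>
  have f_lip: "f v \<le> f w + (L + k * L) * \<bar>v - w\<bar>"
    if vw: "V \<le> v" "v \<le> 1" "V \<le> w" "w \<le> 1" for v w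
    unfolding f_def T_def
  proof (rule cINF_le_add[OF I bdd])
    fix i assume i: "i \<in> I"
    have vw': "0 \<le> v" "0 \<le> w" using vw V by auto
    have "?R (q v) i v - ?R (q v) i w = (1 - q v) * (A i v - A i w) + q v * (B i v - B i w)"
      by (simp add: algebra_simps)
    also have "\<dots> \<le> (1 - q v) * (L * \<bar>v - w\<bar>) + q v * (L * \<bar>v - w\<bar>)"
      using lipschitz(1)[of i v w] lipschitz(2)[of i v w] q_range[of v] i vw vw'
      by (intro add_mono mult_left_mono) auto
    also have "\<dots> = L * \<bar>v - w\<bar>" by (simp add: algebra_simps)
    finally have 1: "?R (q v) i v - ?R (q v) i w \<le> L * \<bar>v - w\<bar>" .
    have "?R (q v) i w - ?R (q w) i w = (q v - q w) * (B i w - A i w)"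
      by (simp add: algebra_simps)
    also have "\<dots> \<le> \<bar>q v - q w\<bar> * \<bar>B i w - A i w\<bar>"
      unfolding abs_mult[symmetric] by simp
    also have "\<dots> \<le> (k * \<bar>v - w\<bar>) * L"
    proof (rule mult_mono)
      show "\<bar>q v - q w\<bar> \<le> k * \<bar>v - w\<bar>"
        using k by (simp add: q_def abs_mult abs_minus_commute flip: right_diff_distrib)
      show "\<bar>B i w - A i w\<bar> \<le> L"
        using nonneg(1)[OF i, of w] nonneg(2)[OF i, of w]
          bounded(1)[OF i, of w] bounded(2)[OF i, of w] vw vw' by linarith
    qed (use k in auto)
    finally show "?R (q v) i v \<le> ?R (q w) i w + (L + k * L) * \<bar>v - w\<bar>"
      using 1 by (simp add: algebra_simps)
  qed (use q_range vw in auto)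
  have f_cont: "continuous_on {V..1} f"
  proof (rule lipschitz_on_continuous_on[of "L + k * L"], rule lipschitz_onI)
    fix v w assume "v \<in> {V..1}" "w \<in> {V..1}"
    then show "dist (f v) (f w) \<le> (L + k * L) * dist v w"
      using f_lip[of v w] f_lip[of w v] by (auto simp: dist_real_def abs_le_iff abs_minus_commute)
  qed (use k L in auto)
  have f1: "\<delta> < f 1" using start by (simp add: f_def T_def q_def)
  have fV: "f V < \<delta>"
    using T_le[of \<theta>0 j V] terminal \<theta>0 by (simp add: f_def qV)

  define S where "S = {V..1} \<inter> f -` {..\<delta>}"
  have "closed S"
    unfolding S_def using f_cont by (intro continuous_closed_preimage) auto
  moreover have "V \<in> S" using fV V by (simp add: S_def)
  then have "S \<noteq> {}" by blast
  moreover have "bdd_above S" unfolding S_def by (auto intro: bdd_aboveI[of _ 1])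
  ultimately have "Sup S \<in> S" by (intro closed_contains_Sup)
  define v where "v = Sup S"
  have v: "V \<le> v" "v \<le> 1" "f v \<le> \<delta>" using \<open>Sup S \<in> S\<close> by (auto simp: S_def v_def)
  have above: "\<delta> < f w" if "v < w" "w \<le> 1" for w
  proof (rule ccontr)
    assume "\<not> \<delta> < f w"
    then have "w \<in> S" using that v by (simp add: S_def)
    then have "w \<le> v" unfolding v_def using \<open>bdd_above S\<close> by (rule cSup_upper)
    then show False using that by simp
  qed
  have fv: "f v = \<delta>"
  proof -
    have "continuous_on {v..1} f" using f_cont by (rule continuous_on_subset) (use v in auto)
    then obtain x where x: "v \<le> x" "x \<le> 1" "f x = \<delta>"
      using IVT'[of f v \<delta> 1] v f1 by auto
    then show ?thesis using above[of x] by (cases "x = v") auto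
  qed
  have "v < 1" using fv f1 v by (cases "v = 1") auto

  define \<theta> where "\<theta> = q v"
  have \<theta>: "0 \<le> \<theta>" "\<theta> \<le> \<theta>0" "\<theta> \<le> 1" using q_range v by (auto simp: \<theta>_def)
  have Tv: "T \<theta> v = \<delta>" using fv by (simp add: f_def \<theta>_def)
  have right: "\<delta> + \<iota> * (k * (w - v)) \<le> T \<theta> w" if w: "v < w" "w \<le> 1" "k * (w - v) \<le> 1" for w
    unfolding T_def
  proof (rule cINF_greatest[OF I])
    fix i assume i: "i \<in> I"
    define d where "d = k * (w - v)"
    have d: "0 \<le> d" "d \<le> 1" "\<theta> = q w + d"
      using k w by (auto simp: d_def \<theta>_def q_def algebra_simps)
    have w': "V \<le> w" using w v by simp
    show "\<delta> + \<iota> * (k * (w - v)) \<le> ?R \<theta> i w"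
    \<comment> \<open>A value below \<delta> + \<iota> d would put B more than \<iota> above A.
      Lowering the weight by d to \<open>q w\<close> would then remove at least \<iota> d and bring
      the value below \<delta>, against the choice of v.\<close>
    proof (rule ccontr)
      assume "\<not> \<delta> + \<iota> * (k * (w - v)) \<le> ?R \<theta> i w"
      then have less: "?R \<theta> i w < \<delta> + \<iota> * d" by (simp add: d_def)
      also have "\<dots> \<le> \<delta> + \<iota>" using d \<iota> by simp
      also have "\<dots> \<le> B i w - \<iota>" using far[OF i w' w(2)] by simp
      finally have *: "\<iota> < (1 - \<theta>) * (B i w - A i w)" by (simp add: algebra_simps)
      then have "0 < (1 - \<theta>) * (B i w - A i w)" using \<iota> by simp
      then have "0 < B i w - A i w" using \<theta> by (simp add: zero_less_mult_iff)
      then have "(1 - \<theta>) * (B i w - A i w) \<le> 1 * (B i w - A i w)"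
        using \<theta> by (intro mult_right_mono) auto
      then have "\<iota> * d \<le> (B i w - A i w) * d"
        using * d by (intro mult_right_mono) auto
      moreover have "?R \<theta> i w = ?R (q w) i w + (B i w - A i w) * d"
        unfolding d(3) by (simp add: algebra_simps)
      moreover have "\<delta> < ?R (q w) i w"
        using above[OF w(1,2)] T_le[of "q w" i w] q_range[OF w' w(2)] i by (simp add: f_def)
      ultimately show False using less by linarith
    qed
  qed
  have T_semiconcave: "T \<theta> (v + h) + T \<theta> (v - h) \<le> 2 * \<delta> + L * h\<^sup>2"
    if h: "0 \<le> h" "h \<le> v" "v + h \<le> 1" for h
  proof (rule field_le_epsilon)
    fix \<eta> :: real assume "0 < \<eta>"
    \<comment> \<open>The infimum may not be attained, so an index optimal up to \<eta> / 2 at v is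
      used at both neighbours.\<close>
    then have "T \<theta> v < \<delta> + \<eta> / 2" using Tv by simp
    then obtain i where i: "i \<in> I" "?R \<theta> i v < \<delta> + \<eta> / 2"
      unfolding T_def using I bdd[OF \<theta>(1,3)] by (subst (asm) cINF_less_iff) auto
    have "T \<theta> (v + h) + T \<theta> (v - h) \<le> ?R \<theta> i (v + h) + ?R \<theta> i (v - h)"
      using \<theta> i by (intro add_mono T_le)
    also have "\<dots> - 2 * ?R \<theta> i v = (1 - \<theta>) * (A i (v + h) + A i (v - h) - 2 * A i v)
        + \<theta> * (B i (v + h) + B i (v - h) - 2 * B i v)"
      by (simp add: algebra_simps)
    also have "\<dots> \<le> (1 - \<theta>) * (L * h\<^sup>2) + \<theta> * (L * h\<^sup>2)"
      using \<theta> i h by (intro add_mono mult_left_mono semiconcave) auto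
    also have "\<dots> = L * h\<^sup>2" by (simp add: algebra_simps)
    finally show "T \<theta> (v + h) + T \<theta> (v - h) \<le> 2 * \<delta> + L * h\<^sup>2 + \<eta>"
      using i(2) by simp
  qed

  \<comment> \<open>The entries keep v - h positive, v + h at most 1 and the weight change at most
    1; the last makes the quadratic error L h^2 smaller than the linear gain \<iota> k h, with L + 1
    guarding against L = 0.\<close>
  define e where "e = Min {v / 2, 1 - v, 1 / k, \<iota> * k / (L + 1)}"
  have v0: "0 < v" using v V by simp
  have "0 < e" using v0 \<open>v < 1\<close> k \<iota> L by (simp add: e_def)
  moreover have "e \<le> v / 2" "e \<le> 1 - v" "e \<le> 1 / k" "e \<le> \<iota> * k / (L + 1)"
    unfolding e_def by (rule Min_le; simp)+
  ultimately have e: "0 < e" "e \<le> v / 2" "e \<le> 1 - v" "e \<le> 1 / k" "e \<le> \<iota> * k / (L + 1)"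
    by auto
  have right': "\<delta> + \<iota> * (k * h) \<le> T \<theta> (v + h)" if "0 < h" "h < e" for h
  proof -
    have "k * h \<le> k * (1 / k)" using that e k by (intro mult_left_mono) auto
    then show ?thesis using right[of "v + h"] that e k by simp
  qed
  show ?thesis
  proof (rule that[OF \<theta>(1,2) e(1) _ Tv])
    show "e < v" using e v0 by simp
    show "\<delta> < T \<theta> w" if "v < w" "w < v + e" for w
    proof -
      have "0 < \<iota> * (k * (w - v))" using \<iota> k that by simp
      then show ?thesis using right'[of "w - v"] that by simp
    qed
    show "T \<theta> w < \<delta>" if "v - e < w" "w < v" for w
    proof -
      define h where "h = v - w"
      have h: "0 < h" "h < e" using that by (auto simp: h_def)
      have "T \<theta> (v + h) + T \<theta> w \<le> 2 * \<delta> + L * h\<^sup>2"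
        using T_semiconcave[of h] h e v0 by (simp add: h_def)
      moreover have "\<delta> + \<iota> * (k * h) \<le> T \<theta> (v + h)"
        using right' h by blast
      moreover have "L * h\<^sup>2 < \<iota> * (k * h)"
      proof -
        have "L * h \<le> (L + 1) * h" using h by simp
        also have "\<dots> < (L + 1) * (\<iota> * k / (L + 1))"
          using h e L by (intro mult_strict_left_mono) auto
        also have "\<dots> = \<iota> * k" using L by simp
        finally have "L * h * h < \<iota> * k * h" using h by (intro mult_strict_right_mono) auto
        then show ?thesis by (simp add: power2_eq_square mult.assoc)
      qed
      ultimately show ?thesis by linarith
    qed
  qed
qed

section \<open>Mixtures and laws with finite support\<close>

definition mix_pmf :: "real \<Rightarrow> 'a pmf \<Rightarrow> 'a pmf \<Rightarrow> 'a pmf" where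
  "mix_pmf \<theta> q r = bind_pmf (bernoulli_pmf \<theta>) (\<lambda>b. if b then r else q)"

lemma finite_set_mix_pmf:
  "finite (set_pmf q) \<Longrightarrow> finite (set_pmf r) \<Longrightarrow> finite (set_pmf (mix_pmf \<theta> q r))"
  unfolding mix_pmf_def by (auto simp: set_bind_pmf)

lemma expectation_mix_pmf:
  fixes f :: "'a \<Rightarrow> real"
  assumes "finite (set_pmf q)" "finite (set_pmf r)" "0 \<le> \<theta>" "\<theta> \<le> 1"
  shows "measure_pmf.expectation (mix_pmf \<theta> q r) f
    = (1 - \<theta>) * measure_pmf.expectation q f + \<theta> * measure_pmf.expectation r f"
  unfolding mix_pmf_def
  by (subst pmf_expectation_bind[of "UNIV :: bool set"]) (use assms in \<open>auto simp: UNIV_bool\<close>)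

lemma prob_mix_pmf:
  assumes "finite (set_pmf q)" "finite (set_pmf r)" "0 \<le> \<theta>" "\<theta> \<le> 1"
  shows "measure_pmf.prob (mix_pmf \<theta> q r) X
    = (1 - \<theta>) * measure_pmf.prob q X + \<theta> * measure_pmf.prob r X"
  using expectation_mix_pmf[OF assms, of "indicator X"] by simp

text \<open>\<open>measure_pmf\<close> carries the discrete sigma-algebra, while
  \<open>real_distribution\<close> asks for the Borel one; the identity transports the law.\<close>

definition borel_pmf :: "real pmf \<Rightarrow> real measure" where
  "borel_pmf q = distr (measure_pmf q) borel (\<lambda>x. x)"

lemma real_distribution_borel_pmf: "real_distribution (borel_pmf q)"
  unfolding borel_pmf_def real_distribution_def real_distribution_axioms_def
  by (auto intro: measure_pmf.prob_space_distr)

lemma averaged_risk_borel_pmf: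
  assumes "0 \<le> p" "p < 1" "0 \<le> \<tau>"
  shows "averaged_risk p (borel_pmf q) \<tau> v
    = measure_pmf.expectation q (\<lambda>x. point_risk p \<tau> (x * v))"
proof -
  note [measurable] = point_risk_borel_measurable[OF assms]
  show ?thesis unfolding averaged_risk_def borel_pmf_def by (subst integral_distr) auto
qed

lemma averaged_risk_borel_pmf_finite:
  assumes "0 \<le> p" "p < 1" "0 \<le> \<tau>" "finite (set_pmf q)"
  shows "averaged_risk p (borel_pmf q) \<tau> v
    = (\<Sum>x\<in>set_pmf q. pmf q x * point_risk p \<tau> (x * v))"
  unfolding averaged_risk_borel_pmf[OF assms(1-3)]
  by (subst integral_measure_pmf_real[OF assms(4)]) (auto simp: mult.commute)

lemma averaged_risk_mix:
  assumes "0 \<le> p" "p < 1" "0 \<le> \<tau>" "finite (set_pmf q)" "finite (set_pmf r)" "0 \<le> \<theta>" "\<theta> \<le> 1"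
  shows "averaged_risk p (borel_pmf (mix_pmf \<theta> q r)) \<tau> v
    = (1 - \<theta>) * averaged_risk p (borel_pmf q) \<tau> v + \<theta> * averaged_risk p (borel_pmf r) \<tau> v"
  using assms by (simp add: averaged_risk_borel_pmf expectation_mix_pmf)

lemma averaged_risk_return:
  assumes "0 \<le> p" "p < 1" "0 \<le> \<tau>"
  shows "averaged_risk p (borel_pmf (return_pmf x)) \<tau> v = point_risk p \<tau> (x * v)"
  using assms by (simp add: averaged_risk_borel_pmf)

lemma borel_pmf_sparse:
  assumes "finite (set_pmf q)" "measure_pmf.prob q {x. x \<noteq> 0} \<le> \<epsilon>"
  shows "borel_pmf q \<in> sparse_distributions \<epsilon>"
proof -
  have "integrable (borel_pmf q) (\<lambda>x. x\<^sup>2)"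
    unfolding borel_pmf_def using assms(1)
    by (subst integrable_distr_eq) (auto intro: integrable_measure_pmf_finite)
  moreover have "measure (borel_pmf q) {x. x \<noteq> 0} = measure_pmf.prob q {x. x \<noteq> 0}"
    unfolding borel_pmf_def by (subst measure_distr) auto
  ultimately show ?thesis
    using assms real_distribution_borel_pmf by (simp add: sparse_distributions_def)
qed

section \<open>Fixed points of state evolution\<close>

text \<open>A threshold good for the worst two-point law is fixed. Its risk is a at the origin and
  at most g elsewhere, so only P(X \<noteq> 0) matters; since a \<le> g, the bound grows with that
  probability and is worst at \<epsilon>.\<close>

lemma normalized_risk_le_of_M_upper:
  assumes p: "0 \<le> p" "p < 1" and \<epsilon>: "0 \<le> \<epsilon>" "\<epsilon> \<le> 1"
    and less: "M_upper p \<epsilon> < \<delta>" and M: "M \<in> sparse_distributions \<epsilon>"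
  shows "normalized_risk p M v < \<delta>"
proof -
  interpret M: real_distribution M using M by (simp add: sparse_distributions_def)
  have bdd: "bdd_above ((\<lambda>m. two_point_risk p \<epsilon> m \<tau>) ` {0..})" if "0 \<le> \<tau>" for \<tau>
  proof (rule bdd_aboveI2)
    fix m :: real
    let ?K = "\<integral>z. ((1 + 2 * \<tau>) + \<bar>z\<bar>)\<^sup>2 \<partial>std_normal_distribution"
    show "two_point_risk p \<epsilon> m \<tau> \<le> (1 - \<epsilon>) * ?K + \<epsilon> * ?K"
      unfolding two_point_risk_eq using \<epsilon> point_risk_bounded[OF p that]
      by (intro add_mono mult_left_mono) auto
  qed
  have "bdd_below ((\<lambda>\<tau>. SUP m\<in>{0..}. two_point_risk p \<epsilon> m \<tau>) ` {0..})"
  proof (rule bdd_belowI2)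
    fix \<tau> :: real assume "\<tau> \<in> {0..}"
    then have "two_point_risk p \<epsilon> 0 \<tau> \<le> (SUP m\<in>{0..}. two_point_risk p \<epsilon> m \<tau>)"
      by (intro cSUP_upper bdd) auto
    moreover have "0 \<le> two_point_risk p \<epsilon> 0 \<tau>"
      using \<epsilon> by (simp add: two_point_risk_eq point_risk_nonneg)
    ultimately show "0 \<le> (SUP m\<in>{0..}. two_point_risk p \<epsilon> m \<tau>)" by simp
  qed
  then obtain \<tau> where \<tau>: "0 \<le> \<tau>" "(SUP m\<in>{0..}. two_point_risk p \<epsilon> m \<tau>) < \<delta>"
    using less unfolding M_upper_def by (subst (asm) cINF_less_iff) auto
  define c where "c = (SUP m\<in>{0..}. two_point_risk p \<epsilon> m \<tau>)"
  define a where "a = point_risk p \<tau> 0"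
  have c: "(1 - \<epsilon>) * a + \<epsilon> * point_risk p \<tau> m \<le> c" for m
  proof -
    have "two_point_risk p \<epsilon> \<bar>m\<bar> \<tau> \<le> c"
      unfolding c_def using \<tau> by (intro cSUP_upper bdd) auto
    then show ?thesis using point_risk_abs[OF p \<tau>(1)] by (simp add: two_point_risk_eq a_def)
  qed
  \<comment> \<open>The choice \<mu> = 0 in the supremum; it is what allows a \<le> g.\<close>
  have a: "a \<le> c" using c[of 0] by (simp add: a_def algebra_simps)
  define s where "s = measure M {x. x \<noteq> 0}"
  have s: "0 \<le> s" "s \<le> \<epsilon>" using M by (auto simp: s_def sparse_distributions_def)
  \<comment> \<open>For \<epsilon> = 0 the supremum says nothing about nonzero points, hence the
    guard in the last clause; the law then has no mass there.\<close>
  obtain g where g: "a \<le> g" "(1 - \<epsilon>) * a + \<epsilon> * g \<le> c"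
    "\<And>m. 0 < \<epsilon> \<Longrightarrow> point_risk p \<tau> m \<le> g"
  proof (cases "\<epsilon> = 0")
    case True
    then show ?thesis using that[of a] a by simp
  next
    case False
    then have "0 < \<epsilon>" using \<epsilon> by simp
    show ?thesis
    proof (rule that[of "(c - (1 - \<epsilon>) * a) / \<epsilon>"])
      have "\<epsilon> * a \<le> c - (1 - \<epsilon>) * a" using a by (simp add: algebra_simps)
      then show "a \<le> (c - (1 - \<epsilon>) * a) / \<epsilon>" using \<open>0 < \<epsilon>\<close> by (simp add: field_simps)
      show "point_risk p \<tau> m \<le> (c - (1 - \<epsilon>) * a) / \<epsilon>" for m
        using c[of m] \<open>0 < \<epsilon>\<close> by (simp add: field_simps)
    qed (use \<open>0 < \<epsilon>\<close> in simp)
  qed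
  have sets: "{x. x \<noteq> 0} \<in> sets M" by simp
  have "averaged_risk p M \<tau> v \<le> (\<integral>x. a + (g - a) * indicator {x. x \<noteq> 0} x \<partial>M)"
    unfolding averaged_risk_def
  proof (rule integral_mono_AE)
    show "integrable M (\<lambda>x. point_risk p \<tau> (x * v))"
      using point_risk_integrable_distribution[OF p M.real_distribution_axioms \<tau>(1)] .
    show "integrable M (\<lambda>x. a + (g - a) * indicator {x. x \<noteq> 0} x)"
      using sets by (auto simp: M.emeasure_eq_measure intro!: integrable_real_indicator)
    show "AE x in M. point_risk p \<tau> (x * v) \<le> a + (g - a) * indicator {x. x \<noteq> 0} x"
    proof (cases "\<epsilon> = 0")
      case True
      then have "measure M {x. x \<noteq> 0} = 0" using s by (simp add: s_def measure_le_0_iff)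
      then have "AE x in M. x \<notin> {x. x \<noteq> 0}"
        using sets by (intro AE_not_in) (simp add: null_sets_def M.emeasure_eq_measure)
      then show ?thesis by eventually_elim (simp add: a_def)
    next
      case False
      then show ?thesis
        using g(3) \<epsilon> by (intro AE_I2) (auto simp: indicator_def a_def)
    qed
  qed
  also have "\<dots> = a + (g - a) * s"
    using sets M.prob_space by (simp add: M.emeasure_eq_measure s_def integrable_real_indicator)
  also have "\<dots> \<le> a + (g - a) * \<epsilon>"
    using g s by (intro add_left_mono mult_left_mono) auto
  also have "\<dots> \<le> c" using g(2) by (simp add: algebra_simps)
  also have "\<dots> < \<delta>" using \<tau>(2) by (simp add: c_def)
  finally show ?thesis using normalized_risk_le[OF \<tau>(1), of p M v] by simp
qed

section \<open>Stability of zero and laws with a second fixed point\<close>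

lemma point_risk_zero_small:
  assumes p: "0 \<le> p" "p < 1" and "0 < e"
  obtains \<tau> where "0 \<le> \<tau>" "point_risk p \<tau> 0 < e"
proof -
  have "\<forall>\<^sub>F n in sequentially. point_risk p (real n) 0 < e"
    using point_risk_large_threshold[OF p, of 0] \<open>0 < e\<close> by (intro order_tendstoD(2)) auto
  then obtain n :: nat where "point_risk p (real n) 0 < e"
    by (auto simp: eventually_sequentially)
  then show ?thesis using that[of "real n"] by simp
qed

text \<open>One threshold with origin risk a below the slack \<delta> - s suffices: as v grows, the
  risk at each nonzero atom tends to 1, so the averaged risk tends to at most a + s <
  \<delta>.\<close>

lemma stable_zero_of_sparse:
  assumes p: "0 \<le> p" "p < 1" and q: "finite (set_pmf q)"
    and less: "measure_pmf.prob q {x. x \<noteq> 0} < \<delta>"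
  shows "stable_fixed_point (state_evolution p \<delta> 0 (borel_pmf q)) 0"
proof -
  define s where "s = measure_pmf.prob q {x. x \<noteq> 0}"
  have s: "0 \<le> s" "s < \<delta>" using less by (auto simp: s_def)
  obtain \<tau> where \<tau>: "0 \<le> \<tau>" "point_risk p \<tau> 0 < \<delta> - s"
    using point_risk_zero_small[OF p, of "\<delta> - s"] s by auto
  define a where "a = point_risk p \<tau> 0"
  have "0 \<le> a" by (simp add: a_def point_risk_nonneg)
  have lim: "((\<lambda>v. point_risk p \<tau> (x * v)) \<longlongrightarrow> (if x = 0 then a else 1)) at_top" for x
  proof (cases "x = 0")
    case False
    then have "filterlim (\<lambda>v. \<bar>x\<bar> * v) at_top at_top"
      by (intro filterlim_tendsto_pos_mult_at_top[of _ "\<bar>x\<bar>"] tendsto_const filterlim_ident) auto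
    from filterlim_compose[OF point_risk_at_top[OF p \<tau>(1)] this]
    have "((\<lambda>v. point_risk p \<tau> (\<bar>x\<bar> * v)) \<longlongrightarrow> 1) at_top" .
    moreover have "point_risk p \<tau> (\<bar>x\<bar> * v) = point_risk p \<tau> (x * v)" for v
      using point_risk_uminus[OF p \<tau>(1), of "x * v"] by (simp add: abs_if)
    ultimately show ?thesis using False by simp
  qed (simp add: a_def)
  have "((\<lambda>v. averaged_risk p (borel_pmf q) \<tau> v)
      \<longlongrightarrow> (\<Sum>x\<in>set_pmf q. pmf q x * (if x = 0 then a else 1))) at_top"
    unfolding averaged_risk_borel_pmf_finite[OF p \<tau>(1) q]
    by (intro tendsto_intros lim)
  moreover have "(\<Sum>x\<in>set_pmf q. pmf q x * (if x = 0 then a else 1)) < \<delta>"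
  proof -
    have "(\<Sum>x\<in>set_pmf q. pmf q x * (if x = 0 then a else 1))
        \<le> (\<Sum>x\<in>set_pmf q. a * pmf q x + indicator {x. x \<noteq> 0} x * pmf q x)"
      using \<open>0 \<le> a\<close> by (intro sum_mono) auto
    also have "\<dots> = a + measure_pmf.expectation q (indicator {x. x \<noteq> 0})"
      using q by (subst integral_measure_pmf_real[OF q])
        (auto simp: sum.distrib sum_pmf_eq_1 simp flip: sum_distrib_left)
    also have "\<dots> < \<delta>" using \<tau> by (simp add: s_def a_def)
    finally show ?thesis .
  qed
  ultimately have "\<forall>\<^sub>F v in at_top. averaged_risk p (borel_pmf q) \<tau> v < \<delta>"
    by (rule order_tendstoD(2))
  then obtain N where N: "\<And>v. N \<le> v \<Longrightarrow> averaged_risk p (borel_pmf q) \<tau> v < \<delta>"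
    by (auto simp: eventually_at_top_linorder)
  show ?thesis
  proof (rule stable_zeroI[OF p real_distribution_borel_pmf])
    show "0 < \<delta>" using s by simp
    define K where "K = max N 1"
    have K: "0 < K" "N \<le> K" by (auto simp: K_def)
    show "0 < 1 / K" using K by simp
    fix x :: real assume x: "0 < x" "x < 1 / K"
    then have "K < 1 / x" using K by (simp add: field_simps)
    then have "averaged_risk p (borel_pmf q) \<tau> (1 / x) < \<delta>" using K by (intro N) simp
    then show "normalized_risk p (borel_pmf q) (1 / x) < \<delta>"
      using normalized_risk_le[OF \<tau>(1), of p "borel_pmf q" "1 / x"] by simp
  qed
qed

text \<open>When epsilon is at least delta, a two-point law is not sparse enough for zero to be stable.
  An atom at m0 with tiny weight w makes up for the deficit of the far atom m1: a threshold above m0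
  costs at least 2w there, and a threshold below m0 leaves noise at the origin, independent of w.\<close>

lemma hard_three_point_pmf:
  assumes p: "0 \<le> p" "p < 1" and \<delta>: "0 < \<delta>" "\<delta> < 1"
  obtains q where "finite (set_pmf q)" "measure_pmf.prob q {x. x \<noteq> 0} \<le> \<delta>"
    "\<delta> < normalized_risk p (borel_pmf q) 1"
proof -
  define c where "c = (\<integral>z. indicat_real {- 0 - 1..- 0} z \<partial>std_normal_distribution)"
  have "0 < c"
    unfolding c_def by (rule std_normal_integral_pos[of _ "- 1" 0])
      (auto simp: std_normal.emeasure_eq_measure intro!: integrable_real_indicator)
  \<comment> \<open>c is the probability of the strip in \<open>point_risk_ge_dead_zone\<close> for
    K = 0; the term 2 / c raises the risk at m0 to at least 2 when \<open>eta\<close> suppresses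
    m0.\<close>
  define m0 where "m0 = 1 + 2 / c"
  have m0: "1 \<le> m0" "2 / c \<le> m0" using \<open>0 < c\<close> by (auto simp: m0_def)
  have "2 \<le> m0 * c" using m0(2) \<open>0 < c\<close> by (simp add: field_simps)
  also have "\<dots> \<le> m0\<^sup>2 * c"
    using m0(1) \<open>0 < c\<close> by (intro mult_right_mono) (auto simp: power2_eq_square)
  finally have m0c: "2 \<le> m0\<^sup>2 * c" .
  define \<alpha> where "\<alpha> = (\<integral>z. (z - m0)\<^sup>2 * indicator {m0..} z \<partial>std_normal_distribution)"
  have "integrable std_normal_distribution (\<lambda>z. (z - m0)\<^sup>2 * indicator {m0..} z)"
  proof (rule Bochner_Integration.integrable_bound[OF std_normal_integrable_quadratic[of m0]])
    have "(z - m0)\<^sup>2 \<le> (m0 + \<bar>z\<bar>)\<^sup>2" for z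
      using m0 by (subst abs_le_square_iff[symmetric]) auto
    then show "AE z in std_normal_distribution.
        norm ((z - m0)\<^sup>2 * indicator {m0..} z) \<le> norm ((m0 + \<bar>z\<bar>)\<^sup>2)"
      by (intro AE_I2) (auto simp: indicator_def)
  qed measurable
  then have "0 < \<alpha>"
    unfolding \<alpha>_def by (rule std_normal_integral_pos[of _ m0 "m0 + 1"]) auto
  \<comment> \<open>Small enough that the origin noise (1 - \<delta>) \<alpha> pays 2 \<delta> w:
    the shortfall 3/2 \<delta> w of the far atom and a surplus \<delta> w / 2.\<close>
  define w where "w = min 1 ((1 - \<delta>) * \<alpha> / (2 * \<delta>))"
  have w: "0 < w" "w \<le> 1" using \<delta> \<open>0 < \<alpha>\<close> by (auto simp: w_def)
  have "w \<le> (1 - \<delta>) * \<alpha> / (2 * \<delta>)" by (simp add: w_def)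
  then have w\<alpha>: "2 * \<delta> * w \<le> (1 - \<delta>) * \<alpha>" using \<delta> by (simp add: field_simps)
  obtain m1 where m1: "\<And>\<tau>. 0 \<le> \<tau> \<Longrightarrow> 1 - w / 2 \<le> point_risk p \<tau> m1"
    using point_risk_uniform_lower_bound[OF p, of "w / 2"] w by (metis half_gt_zero order_refl)
  define r where "r = mix_pmf w (return_pmf m1) (return_pmf m0)"
  define q where "q = mix_pmf \<delta> (return_pmf 0) r"
  have fin: "finite (set_pmf r)" "finite (set_pmf q)"
    by (auto simp: r_def q_def intro!: finite_set_mix_pmf)
  have risk: "averaged_risk p (borel_pmf q) \<tau> 1 = (1 - \<delta>) * point_risk p \<tau> 0
      + \<delta> * ((1 - w) * point_risk p \<tau> m1 + w * point_risk p \<tau> m0)" if "0 \<le> \<tau>" for \<tau>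
    unfolding q_def r_def using p that \<delta> w
    by (simp add: averaged_risk_mix averaged_risk_return finite_set_mix_pmf)
  have bound: "\<delta> + \<delta> * (w / 2) \<le> averaged_risk p (borel_pmf q) \<tau> 1" if \<tau>: "0 \<le> \<tau>" for \<tau>
  proof -
    have "(1 - w) * (1 - w / 2) \<le> (1 - w) * point_risk p \<tau> m1"
      using m1[OF \<tau>] w by (intro mult_left_mono) auto
    moreover have "1 - 3 / 2 * w \<le> (1 - w) * (1 - w / 2)"
      by (simp add: algebra_simps)
    ultimately have far: "1 - 3 / 2 * w \<le> (1 - w) * point_risk p \<tau> m1" by linarith
    show ?thesis
    proof (cases "0 < eta p m0 \<tau>")
      case True
      then have "\<alpha> \<le> point_risk p \<tau> 0"
        unfolding \<alpha>_def by (rule point_risk_zero_ge[OF p \<tau>])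
      then have "(1 - \<delta>) * \<alpha> \<le> (1 - \<delta>) * point_risk p \<tau> 0"
        using \<delta> by (intro mult_left_mono) auto
      moreover have "\<delta> * (1 - 3 / 2 * w) \<le> \<delta> * ((1 - w) * point_risk p \<tau> m1 + w * point_risk p \<tau> m0)"
        using far w \<delta> point_risk_nonneg[of p \<tau> m0] by (intro mult_left_mono add_increasing2) auto
      ultimately show ?thesis
        unfolding risk[OF \<tau>] using w\<alpha> by (simp add: algebra_simps)
    next
      case False
      then have "2 \<le> point_risk p \<tau> m0"
        using point_risk_ge_dead_zone[OF p \<tau>, of m0 0] m0 m0c by (simp add: c_def)
      then have "w * 2 \<le> w * point_risk p \<tau> m0" using w by (intro mult_left_mono) auto
      then have "\<delta> * (1 + w / 2) \<le> \<delta> * ((1 - w) * point_risk p \<tau> m1 + w * point_risk p \<tau> m0)"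
        using far \<delta> by (intro mult_left_mono) auto
      moreover have "0 \<le> (1 - \<delta>) * point_risk p \<tau> 0"
        using \<delta> by (simp add: point_risk_nonneg)
      ultimately show ?thesis unfolding risk[OF \<tau>] by (simp add: algebra_simps)
    qed
  qed
  show ?thesis
  proof (rule that[of q])
    have "measure_pmf.prob q {x. x \<noteq> 0} = \<delta> * measure_pmf.prob r {x. x \<noteq> 0}"
      unfolding q_def using \<delta> fin by (subst prob_mix_pmf) auto
    also have "\<dots> \<le> \<delta> * 1" using \<delta> by (intro mult_left_mono) auto
    finally show "measure_pmf.prob q {x. x \<noteq> 0} \<le> \<delta>" by simp
    have "\<delta> < \<delta> + \<delta> * (w / 2)" using \<delta> w by simp
    also have "\<dots> \<le> normalized_risk p (borel_pmf q) 1"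
      unfolding normalized_risk_def using bound by (intro cINF_greatest) auto
    finally show "\<delta> < normalized_risk p (borel_pmf q) 1" .
  qed (rule fin)
qed

text \<open>The two-point law itself is the witness. Positivity of \<epsilon> follows because
  without mass off 0 a large threshold drives the risk below \<delta>.\<close>

lemma hard_two_point_pmf:
  assumes p: "0 \<le> p" "p < 1" and \<delta>: "0 < \<delta>" and \<epsilon>: "0 \<le> \<epsilon>" "\<epsilon> \<le> 1"
    and M: "\<delta> < M_lower p \<epsilon>"
  obtains q where "finite (set_pmf q)" "measure_pmf.prob q {x. x \<noteq> 0} \<le> \<epsilon>"
    "\<delta> < normalized_risk p (borel_pmf q) 1" "0 < \<epsilon>"
proof -
  obtain m where m: "\<delta> < (INF \<tau>\<in>{0..}. two_point_risk p \<epsilon> m \<tau>)"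
  proof (rule ccontr)
    assume "\<not> thesis"
    then have "(INF \<tau>\<in>{0..}. two_point_risk p \<epsilon> m \<tau>) \<le> \<delta>" for m
      using that by (meson not_le)
    then have "M_lower p \<epsilon> \<le> \<delta>"
      unfolding M_lower_def by (intro cSUP_least) auto
    then show False using M by simp
  qed
  define q where "q = mix_pmf \<epsilon> (return_pmf 0) (return_pmf m)"
  have risk: "averaged_risk p (borel_pmf q) \<tau> 1 = two_point_risk p \<epsilon> m \<tau>" if "0 \<le> \<tau>" for \<tau>
    unfolding q_def two_point_risk_eq using p that \<epsilon>
    by (simp add: averaged_risk_mix averaged_risk_return)
  have less: "\<delta> < normalized_risk p (borel_pmf q) 1"
    using m risk unfolding normalized_risk_def by simp
  show ?thesis
  proof (rule that[OF _ _ less])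
    show "finite (set_pmf q)" by (simp add: q_def finite_set_mix_pmf)
    show "measure_pmf.prob q {x. x \<noteq> 0} \<le> \<epsilon>"
      unfolding q_def using \<epsilon> by (subst prob_mix_pmf) (auto simp: mult_left_le)
    show "0 < \<epsilon>"
    proof (rule ccontr)
      assume "\<not> 0 < \<epsilon>"
      then have "\<epsilon> = 0" using \<epsilon> by simp
      obtain \<tau> where "0 \<le> \<tau>" "point_risk p \<tau> 0 < \<delta>"
        using point_risk_zero_small[OF p \<delta>] .
      then show False
        using less normalized_risk_le[of \<tau> p "borel_pmf q" 1] risk[of \<tau>] \<open>\<epsilon> = 0\<close>
        by (simp add: two_point_risk_eq)
    qed
  qed
qed

text \<open>Atoms lie in [-X, X] and v in [0, 1], so all arguments stay where one constant C
  applies; differences in v cost a factor |x| or x^2, both at most X^2 because X \<ge> 1. Fixing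
  only the support lets one L serve the hard law and the far atom.\<close>

lemma averaged_risk_regular:
  assumes p: "0 \<le> p" "p < 1" and S: "finite S"
  obtains L where "0 \<le> L"
    and "\<And>q \<tau> v. set_pmf q \<subseteq> S \<Longrightarrow> 0 \<le> \<tau> \<Longrightarrow> 0 \<le> v \<Longrightarrow> v \<le> 1 \<Longrightarrow>
      averaged_risk p (borel_pmf q) \<tau> v \<le> L"
    and "\<And>q \<tau> v w. set_pmf q \<subseteq> S \<Longrightarrow> 0 \<le> \<tau> \<Longrightarrow> 0 \<le> v \<Longrightarrow> v \<le> 1 \<Longrightarrow> 0 \<le> w \<Longrightarrow> w \<le> 1 \<Longrightarrow>
      \<bar>averaged_risk p (borel_pmf q) \<tau> v - averaged_risk p (borel_pmf q) \<tau> w\<bar> \<le> L * \<bar>v - w\<bar>"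
    and "\<And>q \<tau> v h. set_pmf q \<subseteq> S \<Longrightarrow> 0 \<le> \<tau> \<Longrightarrow> 0 \<le> h \<Longrightarrow> h \<le> v \<Longrightarrow> v + h \<le> 1 \<Longrightarrow>
      averaged_risk p (borel_pmf q) \<tau> (v + h) + averaged_risk p (borel_pmf q) \<tau> (v - h)
        - 2 * averaged_risk p (borel_pmf q) \<tau> v \<le> L * h\<^sup>2"
proof -
  define X where "X = Max (insert 1 (abs ` S))"
  have X: "1 \<le> X" "\<And>x. x \<in> S \<Longrightarrow> \<bar>x\<bar> \<le> X" using S by (auto simp: X_def)
  obtain C where C: "0 \<le> C"
    "\<And>\<tau> m n. 0 \<le> \<tau> \<Longrightarrow> \<bar>m\<bar> \<le> X \<Longrightarrow> \<bar>n\<bar> \<le> X \<Longrightarrow>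
      \<bar>point_risk p \<tau> m - point_risk p \<tau> n\<bar> \<le> C * \<bar>m - n\<bar>"
    "\<And>\<tau> m h. 0 \<le> \<tau> \<Longrightarrow> 0 \<le> h \<Longrightarrow> \<bar>m\<bar> + h \<le> X \<Longrightarrow>
      point_risk p \<tau> (m + h) + point_risk p \<tau> (m - h) - 2 * point_risk p \<tau> m \<le> C * h\<^sup>2"
    using point_risk_regular[OF p, of X] by metis
  define K where "K = (\<integral>z. (2 * X + \<bar>z\<bar>)\<^sup>2 \<partial>std_normal_distribution)"
  have "0 \<le> K" by (simp add: K_def)
  have K: "point_risk p \<tau> m \<le> K" if "0 \<le> \<tau>" "\<bar>m\<bar> \<le> X" for \<tau> m
    unfolding point_risk_def K_def
  proof (intro integral_mono point_risk_integrable[OF p that(1)] std_normal_integrable_quadratic)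
    fix z :: real
    have "(eta p (m + z) \<tau> - m)\<^sup>2 \<le> (2 * \<bar>m\<bar> + \<bar>z\<bar>)\<^sup>2"
      by (rule point_risk_integrand_le[OF p that(1)])
    also have "\<dots> \<le> (2 * X + \<bar>z\<bar>)\<^sup>2" using that by (intro power_mono) auto
    finally show "(eta p (m + z) \<tau> - m)\<^sup>2 \<le> (2 * X + \<bar>z\<bar>)\<^sup>2" .
  qed
  define L where "L = C * X\<^sup>2 + K"
  have sum_le: "(\<Sum>x\<in>set_pmf q. pmf q x * f x) \<le> c"
    if "set_pmf q \<subseteq> S" "\<And>x. x \<in> S \<Longrightarrow> f x \<le> c" for q c and f :: "real \<Rightarrow> real"
  proof -
    have "(\<Sum>x\<in>set_pmf q. pmf q x * f x) \<le> (\<Sum>x\<in>set_pmf q. pmf q x * c)"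
      using that by (intro sum_mono mult_left_mono) auto
    also have "\<dots> = c"
      using finite_subset[OF that(1) S] by (simp add: sum_pmf_eq_1 flip: sum_distrib_right)
    finally show ?thesis .
  qed
  note risk = averaged_risk_borel_pmf_finite[OF p _ finite_subset[OF _ S]]
  have xv: "\<bar>x * v\<bar> \<le> X" if "x \<in> S" "0 \<le> v" "v \<le> 1" for x v
    using mult_mono[OF X(2)[OF that(1)] that(3)] X that by (simp add: abs_mult)
  have CX: "C * (\<bar>x\<bar> * t) \<le> L * t" if "x \<in> S" "0 \<le> t" for x t
  proof -
    have "\<bar>x\<bar> * 1 \<le> X * X" using X that by (intro mult_mono) auto
    then have "C * \<bar>x\<bar> \<le> L"
      using C(1) \<open>0 \<le> K\<close> by (auto simp: L_def power2_eq_square intro: add_increasing2 mult_left_mono)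
    then show ?thesis using that(2) by (metis mult.assoc mult_right_mono)
  qed
  have lip: "averaged_risk p (borel_pmf q) \<tau> v - averaged_risk p (borel_pmf q) \<tau> w \<le> L * \<bar>v - w\<bar>"
    if q: "set_pmf q \<subseteq> S" and "0 \<le> \<tau>" "0 \<le> v" "v \<le> 1" "0 \<le> w" "w \<le> 1" for q \<tau> v w
  proof -
    have "(\<Sum>x\<in>set_pmf q. pmf q x * (point_risk p \<tau> (x * v) - point_risk p \<tau> (x * w)))
        \<le> L * \<bar>v - w\<bar>"
    proof (rule sum_le[OF q])
      fix x assume x: "x \<in> S"
      have "point_risk p \<tau> (x * v) - point_risk p \<tau> (x * w) \<le> C * \<bar>x * v - x * w\<bar>"
        using C(2)[OF \<open>0 \<le> \<tau>\<close> xv xv, of x v x w] x that by simp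
      also have "\<dots> = C * (\<bar>x\<bar> * \<bar>v - w\<bar>)"
        by (simp add: abs_mult flip: right_diff_distrib)
      also have "\<dots> \<le> L * \<bar>v - w\<bar>" using CX[OF x] by simp
      finally show "point_risk p \<tau> (x * v) - point_risk p \<tau> (x * w) \<le> L * \<bar>v - w\<bar>" .
    qed
    then show ?thesis
      using that by (simp add: risk right_diff_distrib sum_subtractf)
  qed
  show ?thesis
  proof (rule that[of L])
    show "0 \<le> L" using C(1) \<open>0 \<le> K\<close> by (simp add: L_def)
    fix q :: "real pmf" and \<tau> v :: real
    assume q: "set_pmf q \<subseteq> S" and \<tau>: "0 \<le> \<tau>"
    {
      assume v: "0 \<le> v" "v \<le> 1"
      have "K \<le> L" using C(1) by (simp add: L_def)
      then show "averaged_risk p (borel_pmf q) \<tau> v \<le> L"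
        unfolding risk[OF \<tau> q] using K[OF \<tau> xv] v by (intro sum_le[OF q]) (meson order_trans)
      fix w :: real assume w: "0 \<le> w" "w \<le> 1"
      show "\<bar>averaged_risk p (borel_pmf q) \<tau> v - averaged_risk p (borel_pmf q) \<tau> w\<bar> \<le> L * \<bar>v - w\<bar>"
        using lip[OF q \<tau> v w] lip[OF q \<tau> w v] by (simp add: abs_le_iff abs_minus_commute)
    }
    fix h assume h: "0 \<le> h" "h \<le> v" "v + h \<le> 1"
    have "(\<Sum>x\<in>set_pmf q. pmf q x * (point_risk p \<tau> (x * (v + h)) + point_risk p \<tau> (x * (v - h))
        - 2 * point_risk p \<tau> (x * v))) \<le> L * h\<^sup>2"
    proof (rule sum_le[OF q])
      fix x assume x: "x \<in> S"
      \<comment> \<open>The second difference is bounded for nonnegative steps, so |x| h is used;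
        the sign of x only exchanges the two shifted points.\<close>
      have "\<bar>x * v\<bar> + \<bar>x\<bar> * h = \<bar>x * (v + h)\<bar>"
        using h unfolding abs_mult by (simp add: distrib_left)
      also have "\<dots> \<le> X" using x h by (intro xv) auto
      finally have "point_risk p \<tau> (x * v + \<bar>x\<bar> * h) + point_risk p \<tau> (x * v - \<bar>x\<bar> * h)
          - 2 * point_risk p \<tau> (x * v) \<le> C * (\<bar>x\<bar> * h)\<^sup>2"
        using h by (intro C(3)[OF \<tau>]) auto
      also have "\<dots> = C * \<bar>x\<bar>\<^sup>2 * h\<^sup>2" by (simp add: power_mult_distrib)
      also have "\<dots> \<le> L * h\<^sup>2"
        using X(2)[OF x] C(1) \<open>0 \<le> K\<close> unfolding L_def
        by (intro mult_right_mono add_increasing2 mult_left_mono power_mono) auto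
      finally show "point_risk p \<tau> (x * (v + h)) + point_risk p \<tau> (x * (v - h))
          - 2 * point_risk p \<tau> (x * v) \<le> L * h\<^sup>2"
        by (cases "0 \<le> x") (simp_all add: algebra_simps)
    qed
    then show "averaged_risk p (borel_pmf q) \<tau> (v + h) + averaged_risk p (borel_pmf q) \<tau> (v - h)
        - 2 * averaged_risk p (borel_pmf q) \<tau> v \<le> L * h\<^sup>2"
      using q \<tau> by (simp add: risk sum_distrib_left sum.distrib sum_subtractf right_diff_distrib distrib_left mult.left_commute)
  qed
qed

text \<open>At v = 1 the law is hard, and at a small V a large threshold already wins;
  \<open>clean_crossing\<close> between them mixes in a far atom whose weight keeps the law strictly
  sparse.\<close>

lemma positive_stable_fixed_point_exists:
  assumes p: "0 \<le> p" "p < 1" and \<delta>: "0 < \<delta>" "\<delta> < 1" and q: "finite (set_pmf q)"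
    and sparse: "measure_pmf.prob q {x. x \<noteq> 0} < \<beta>" "\<beta> \<le> \<delta>"
    and hard: "\<delta> < normalized_risk p (borel_pmf q) 1"
  obtains r \<sigma> where "finite (set_pmf r)" "measure_pmf.prob r {x. x \<noteq> 0} < \<beta>" "0 < \<sigma>"
    "stable_fixed_point (state_evolution p \<delta> 0 (borel_pmf r)) \<sigma>"
proof -
  define s where "s = measure_pmf.prob q {x. x \<noteq> 0}"
  have s: "0 \<le> s" "s < \<beta>" using sparse by (auto simp: s_def)
  \<comment> \<open>A quarter of the gap, so that \<delta> + 2 \<iota> is the midpoint of \<delta>
    and 1, within reach of a risk close to 1.\<close>
  define \<iota> where "\<iota> = (1 - \<delta>) / 4"
  have \<iota>: "0 < \<iota>" using \<delta> by (simp add: \<iota>_def)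
  obtain m0 where m0: "0 < m0" "\<And>m \<tau>. m0 \<le> m \<Longrightarrow> 0 \<le> \<tau> \<Longrightarrow> \<delta> + 2 * \<iota> \<le> point_risk p \<tau> m"
  proof -
    obtain m0 where "0 < m0"
      "\<And>m \<tau>. m0 \<le> m \<Longrightarrow> 0 \<le> \<tau> \<Longrightarrow> 1 - 2 * \<iota> \<le> point_risk p \<tau> m"
      using point_risk_uniform_lower_bound[OF p, of "2 * \<iota>"] \<iota> by auto
    moreover have "\<delta> + 2 * \<iota> = 1 - 2 * \<iota>" by (simp add: \<iota>_def field_simps)
    ultimately show ?thesis using that by metis
  qed
  define Q where "Q = (\<Sum>x\<in>set_pmf q. pmf q x * x\<^sup>2)"
  have Q: "0 \<le> Q" unfolding Q_def by (intro sum_nonneg) auto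
  \<comment> \<open>With a large threshold the risk at V is near V^2 times the second moment Q; this
    choice gives V^2 Q \<le> V Q < \<delta>.\<close>
  define V where "V = \<delta> / (2 * (Q + 1))"
  have V: "0 < V" "V < 1" using Q \<delta> by (auto simp: V_def)
  have "V * Q < \<delta>" using Q \<delta> by (simp add: V_def field_simps add_nonneg_pos)
  moreover have "V\<^sup>2 * Q \<le> V * Q"
    using V Q by (intro mult_right_mono) (auto simp: power2_eq_square mult_left_le)
  ultimately have VQ: "V\<^sup>2 * Q < \<delta>" by simp
  define A where "A = (\<lambda>\<tau> v. averaged_risk p (borel_pmf q) \<tau> v)"
  have "(\<lambda>n. \<Sum>x\<in>set_pmf q. pmf q x * point_risk p (real n) (x * V))
      \<longlonglongrightarrow> (\<Sum>x\<in>set_pmf q. pmf q x * (x * V)\<^sup>2)"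
    by (intro tendsto_intros point_risk_large_threshold[OF p])
  then have "(\<lambda>n. A (real n) V) \<longlonglongrightarrow> V\<^sup>2 * Q"
    using p q by (simp add: A_def averaged_risk_borel_pmf_finite Q_def sum_distrib_left
        power_mult_distrib mult_ac)
  then have "\<forall>\<^sub>F n in sequentially. A (real n) V < \<delta>"
    using VQ by (rule order_tendstoD(2))
  then obtain n :: nat where n: "A (real n) V < \<delta>"
    by (auto simp: eventually_sequentially)
  \<comment> \<open>Dividing by V keeps \<open>m1 * v\<close> beyond m0 on all of [V, 1].\<close>
  define m1 where "m1 = m0 / V"
  define B where "B = (\<lambda>\<tau> v. averaged_risk p (borel_pmf (return_pmf m1)) \<tau> v)"
  \<comment> \<open>The first entry keeps the mass off 0 below \<beta>, the second keeps the risk at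
    V below \<delta> after adding the far atom.\<close>
  define \<theta>0 where "\<theta>0 = min ((\<beta> - s) / 2) ((\<delta> - A (real n) V) / (2 * (B (real n) V + 1)))"
  have B0: "0 \<le> B \<tau> v" and A0: "0 \<le> A \<tau> v" for \<tau> v
    by (auto simp: A_def B_def averaged_risk_nonneg)
  have "\<theta>0 \<le> (\<beta> - s) / 2" unfolding \<theta>0_def by (rule min.cobounded1)
  moreover have "0 < \<theta>0" using s n B0[of "real n" V] by (simp add: \<theta>0_def)
  ultimately have \<theta>0: "0 < \<theta>0" "\<theta>0 \<le> (\<beta> - s) / 2" "\<theta>0 \<le> 1"
    using s sparse \<delta> by auto
  have terminal: "(1 - \<theta>0) * A (real n) V + \<theta>0 * B (real n) V < \<delta>"
  proof -
    have "\<theta>0 * (2 * (B (real n) V + 1)) \<le> \<delta> - A (real n) V"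
      using B0[of "real n" V] by (simp add: \<theta>0_def min_le_iff_disj flip: pos_le_divide_eq)
    moreover have "0 \<le> \<theta>0 * B (real n) V" "0 \<le> \<theta>0 * A (real n) V"
      using \<theta>0 B0 A0 by auto
    ultimately show ?thesis using \<theta>0(1) by (simp add: algebra_simps)
  qed
  obtain L where L: "0 \<le> L"
    "\<And>r \<tau> v. set_pmf r \<subseteq> insert m1 (set_pmf q) \<Longrightarrow> 0 \<le> \<tau> \<Longrightarrow> 0 \<le> v \<Longrightarrow> v \<le> 1 \<Longrightarrow>
      averaged_risk p (borel_pmf r) \<tau> v \<le> L"
    "\<And>r \<tau> v w. set_pmf r \<subseteq> insert m1 (set_pmf q) \<Longrightarrow> 0 \<le> \<tau> \<Longrightarrow> 0 \<le> v \<Longrightarrow> v \<le> 1 \<Longrightarrow> 0 \<le> w \<Longrightarrow> w \<le> 1 \<Longrightarrow>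
      \<bar>averaged_risk p (borel_pmf r) \<tau> v - averaged_risk p (borel_pmf r) \<tau> w\<bar> \<le> L * \<bar>v - w\<bar>"
    "\<And>r \<tau> v h. set_pmf r \<subseteq> insert m1 (set_pmf q) \<Longrightarrow> 0 \<le> \<tau> \<Longrightarrow> 0 \<le> h \<Longrightarrow> h \<le> v \<Longrightarrow> v + h \<le> 1 \<Longrightarrow>
      averaged_risk p (borel_pmf r) \<tau> (v + h) + averaged_risk p (borel_pmf r) \<tau> (v - h)
        - 2 * averaged_risk p (borel_pmf r) \<tau> v \<le> L * h\<^sup>2"
    by (rule averaged_risk_regular[OF p, of "insert m1 (set_pmf q)"]) (use q in auto)
  have sub: "set_pmf q \<subseteq> insert m1 (set_pmf q)" "set_pmf (return_pmf m1) \<subseteq> insert m1 (set_pmf q)"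
    by auto
  have start: "\<delta> < (INF \<tau>\<in>{0..}. A \<tau> 1)"
    using hard by (simp add: normalized_risk_def A_def)
  have far: "\<delta> + 2 * \<iota> \<le> B \<tau> v" if "\<tau> \<in> {0..}" "V \<le> v" "v \<le> 1" for \<tau> v
  proof -
    have "m0 \<le> m1 * v"
      using that V m0(1) by (simp add: m1_def field_simps)
    then show ?thesis using m0(2) that p by (simp add: B_def averaged_risk_return)
  qed
  obtain \<theta> v e where \<theta>: "0 \<le> \<theta>" "\<theta> \<le> \<theta>0" and v: "0 < e" "e < v"
    and T: "(INF \<tau>\<in>{0..}. (1 - \<theta>) * A \<tau> v + \<theta> * B \<tau> v) = \<delta>"
      "\<And>w. v - e < w \<Longrightarrow> w < v \<Longrightarrow> (INF \<tau>\<in>{0..}. (1 - \<theta>) * A \<tau> w + \<theta> * B \<tau> w) < \<delta>"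
      "\<And>w. v < w \<Longrightarrow> w < v + e \<Longrightarrow> \<delta> < (INF \<tau>\<in>{0..}. (1 - \<theta>) * A \<tau> w + \<theta> * B \<tau> w)"
    by (rule clean_crossing[OF V L(1) \<theta>0(1,3), where I = "{0..}" and A = A and B = B and \<delta> = \<delta>
          and \<iota> = \<iota> and j = "real n"])
      (use L(2-4)[OF sub(1)] L(2-4)[OF sub(2)] A0 B0 far \<iota> start terminal in
        \<open>auto simp: A_def B_def\<close>)
  define r where "r = mix_pmf \<theta> q (return_pmf m1)"
  have \<theta>1: "\<theta> \<le> 1" using \<theta> \<theta>0 by simp
  have r: "normalized_risk p (borel_pmf r) w = (INF \<tau>\<in>{0..}. (1 - \<theta>) * A \<tau> w + \<theta> * B \<tau> w)" for w
    unfolding normalized_risk_def r_def A_def B_def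
    using p q \<theta> \<theta>1 by (intro INF_cong refl averaged_risk_mix) auto
  show ?thesis
  proof (rule that[of r "1 / v"])
    show "finite (set_pmf r)" by (simp add: r_def q finite_set_mix_pmf)
    have "measure_pmf.prob r {x. x \<noteq> 0} = (1 - \<theta>) * s + \<theta> * measure_pmf.prob (return_pmf m1) {x. x \<noteq> 0}"
      unfolding r_def s_def using q \<theta> \<theta>1 by (intro prob_mix_pmf) auto
    also have "\<dots> \<le> 1 * s + \<theta> * 1"
      using \<theta> s by (intro add_mono mult_mono) auto
    also have "\<dots> < \<beta>" using \<theta> \<theta>0 s by simp
    finally show "measure_pmf.prob r {x. x \<noteq> 0} < \<beta>" .
    show "0 < 1 / v" using v by simp
    show "stable_fixed_point (state_evolution p \<delta> 0 (borel_pmf r)) (1 / v)"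
      using v T by (intro stable_posI[OF p real_distribution_borel_pmf \<delta>(1), of v e])
        (auto simp: r)
  qed
qed

theorem theorem3:
  fixes p \<delta> \<epsilon> :: real
  assumes "0 \<le> p" and "p < 1"
    and "0 < \<delta>" and "\<delta> < 1"
    and "0 \<le> \<epsilon>" and "\<epsilon> \<le> 1"
  shows
    "(M_upper p \<epsilon> < \<delta> \<longrightarrow>
        (\<forall>M\<in>sparse_distributions \<epsilon>.
           {\<sigma>. stable_fixed_point (state_evolution p \<delta> 0 M) \<sigma>} = {0}))
     \<and>
     (M_lower p \<epsilon> > \<delta> \<longrightarrow>
        (\<exists>M\<in>sparse_distributions \<epsilon>.
           \<exists>\<sigma>\<^sub>1 \<sigma>\<^sub>2. \<sigma>\<^sub>1 \<noteq> \<sigma>\<^sub>2 \<and>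
             stable_fixed_point (state_evolution p \<delta> 0 M) \<sigma>\<^sub>1 \<and>
             stable_fixed_point (state_evolution p \<delta> 0 M) \<sigma>\<^sub>2))"
proof (intro conjI impI ballI)
  fix M assume less: "M_upper p \<epsilon> < \<delta>" and M: "M \<in> sparse_distributions \<epsilon>"
  have rd: "real_distribution M" using M by (simp add: sparse_distributions_def)
  \<comment> \<open>This single strict bound excludes positive fixed points and makes zero
    stable.\<close>
  have risk: "normalized_risk p M v < \<delta>" for v
    using normalized_risk_le_of_M_upper assms less M by blast
  show "{\<sigma>. stable_fixed_point (state_evolution p \<delta> 0 M) \<sigma>} = {0}"
  proof (intro equalityI subsetI)
    fix \<sigma> assume "\<sigma> \<in> {\<sigma>. stable_fixed_point (state_evolution p \<delta> 0 M) \<sigma>}"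
    moreover have "state_evolution p \<delta> 0 M (\<sigma>\<^sup>2) \<noteq> \<sigma>\<^sup>2" if "0 < \<sigma>"
      using state_evolution_cmp(3)[OF assms(1,2) rd that assms(3)] risk[of "1 / \<sigma>"] by simp
    ultimately show "\<sigma> \<in> {0}" by (auto simp: stable_fixed_point_def)
  next
    fix \<sigma> :: real assume "\<sigma> \<in> {0}"
    then show "\<sigma> \<in> {\<sigma>. stable_fixed_point (state_evolution p \<delta> 0 M) \<sigma>}"
      using stable_zeroI[OF assms(1,2) rd assms(3), of 1] risk by simp
  qed
next
  assume less: "\<delta> < M_lower p \<epsilon>"
  \<comment> \<open>Below \<epsilon> for membership in the class, below \<delta> for stability of
    zero.\<close>
  define \<beta> where "\<beta> = min \<epsilon> \<delta>"
  obtain q where q: "finite (set_pmf q)" "measure_pmf.prob q {x. x \<noteq> 0} \<le> \<beta>"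
    "\<delta> < normalized_risk p (borel_pmf q) 1" and "0 < \<epsilon>"
  proof -
    obtain q where q: "finite (set_pmf q)" "measure_pmf.prob q {x. x \<noteq> 0} \<le> \<epsilon>"
      "\<delta> < normalized_risk p (borel_pmf q) 1" and \<epsilon>: "0 < \<epsilon>"
      using hard_two_point_pmf[OF assms(1-3,5,6) less] .
    obtain r where r: "finite (set_pmf r)" "measure_pmf.prob r {x. x \<noteq> 0} \<le> \<delta>"
      "\<delta> < normalized_risk p (borel_pmf r) 1"
      using hard_three_point_pmf[OF assms(1-4)] .
    show ?thesis
      \<comment> \<open>For \<epsilon> > \<delta> the two-point law may carry too much mass off 0,
        so the three-point law with at most \<delta> there takes its place.\<close>
      by (cases "\<epsilon> \<le> \<delta>") (use that[of q] that[of r] q r \<epsilon> in \<open>auto simp: \<beta>_def\<close>)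
  qed
  have "0 < \<beta>" using assms \<open>0 < \<epsilon>\<close> by (simp add: \<beta>_def)
  define \<gamma> where "\<gamma> = normalized_risk p (borel_pmf q) 1"
  \<comment> \<open>The midpoint of \<delta> / \<gamma> and 1: t < 1 makes sparsity strict, and t
    \<gamma> > \<delta> keeps the diluted law hard.\<close>
  define t where "t = (1 + \<delta> / \<gamma>) / 2"
  have \<gamma>: "\<delta> < \<gamma>" using q by (simp add: \<gamma>_def)
  then have t: "0 \<le> t" "t < 1" "\<delta> < t * \<gamma>"
    using assms by (auto simp: t_def field_simps)
  define r where "r = mix_pmf t (return_pmf 0) q"
  have "measure_pmf.prob r {x. x \<noteq> 0} = t * measure_pmf.prob q {x. x \<noteq> 0}"
    unfolding r_def using q t by (subst prob_mix_pmf) auto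
  also have "\<dots> \<le> t * \<beta>" using t q by (intro mult_left_mono) auto
  also have "\<dots> < \<beta>" using t \<open>0 < \<beta>\<close> by simp
  finally have sparse: "measure_pmf.prob r {x. x \<noteq> 0} < \<beta>" .
  have "t * \<gamma> \<le> normalized_risk p (borel_pmf r) 1"
    unfolding normalized_risk_def
  proof (rule cINF_greatest)
    fix \<tau> :: real assume "\<tau> \<in> {0..}"
    then have \<tau>: "0 \<le> \<tau>" by simp
    have "t * \<gamma> \<le> t * averaged_risk p (borel_pmf q) \<tau> 1"
      unfolding \<gamma>_def using t \<tau> by (intro mult_left_mono normalized_risk_le) auto
    \<comment> \<open>The mass added at the origin contributes a nonnegative risk, which is
      discarded.\<close>
    also have "\<dots> \<le> averaged_risk p (borel_pmf r) \<tau> 1"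
      unfolding r_def using assms t q \<tau>
      by (subst averaged_risk_mix) (auto intro!: mult_nonneg_nonneg averaged_risk_nonneg)
    finally show "t * \<gamma> \<le> averaged_risk p (borel_pmf r) \<tau> 1" .
  qed simp
  then have "\<delta> < normalized_risk p (borel_pmf r) 1" using t by simp
  then obtain r' \<sigma> where r': "finite (set_pmf r')" "measure_pmf.prob r' {x. x \<noteq> 0} < \<beta>" "0 < \<sigma>"
      "stable_fixed_point (state_evolution p \<delta> 0 (borel_pmf r')) \<sigma>"
    using positive_stable_fixed_point_exists[OF assms(1-4) _ sparse] q(1)
    by (auto simp: \<beta>_def r_def finite_set_mix_pmf)
  have "stable_fixed_point (state_evolution p \<delta> 0 (borel_pmf r')) 0"
    using r' by (intro stable_zero_of_sparse assms) (auto simp: \<beta>_def)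
  moreover have "borel_pmf r' \<in> sparse_distributions \<epsilon>"
    using r' by (intro borel_pmf_sparse) (auto simp: \<beta>_def)
  ultimately show "\<exists>M\<in>sparse_distributions \<epsilon>. \<exists>\<sigma>\<^sub>1 \<sigma>\<^sub>2. \<sigma>\<^sub>1 \<noteq> \<sigma>\<^sub>2 \<and>
      stable_fixed_point (state_evolution p \<delta> 0 M) \<sigma>\<^sub>1 \<and>
      stable_fixed_point (state_evolution p \<delta> 0 M) \<sigma>\<^sub>2"
    using r'(3,4) by (metis less_irrefl)
qed

end
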